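(* Over $\mathsf{RCA}_0$ the following are equivalent: (1) $\mathsf{ACA}_0$; (2) for every countable sequence of graphs $\langle G_i : i\in\mathbb{N}\rangle$ there is a function $f:\mathbb{N}\to\{0,1\}$ such that $f(i)=1$ if $G_i$ is colorable and $f(i)=0$ otherwise.
   Context: Work in second-order arithmetic, whose number variables range over $\mathbb{N}$ and set variables over subsets of $\mathbb{N}$; finite sequences, functions, sequences of graphs, etc. are coded by sets of natural numbers in the standard way. $\mathsf{RCA}_0$ is the subsystem consisting of the basic axioms of Peano arithmetic, induction restricted to $\Sigma^0_1$ formulas, and recursive comprehension (any set definable by both a $\Sigma^0_1$ formula and a $\Pi^0_1$ formula, with set parameters, exists). $\mathsf{ACA}_0$ is $\mathsf{RCA}_0$ together with arithmetical comprehension: every set definable by a formula with no set quantifiers (set parameters allowed) exists. A graph $G=\langle V,E\rangle$ has vertex set $V\subseteq\mathbb{N}$ and edge set $E$ a set of unordered pairs of elements of $V$. A $k$-coloring of $G$ is a function $\chi:V\to\{0,\dots,k-1\}$ with $\chi(x)\ne\chi(y)$ whenever $(x,y)\in E$. $G$ is colorable if there is some $k\in\mathbb{N}$ such that $G$ has a $k$-coloring. *)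

theory Defs
  imports Main
begin

section \<open>The language of second-order arithmetic\<close>

text \<open>Number variables and set variables are two separate families, each indexed by \<open>nat\<close>.\<close>

datatype tm = Var nat | Zero | One
  | Plus tm tm (infixl "\<^bold>+" 85)
  | Times tm tm (infixl "\<^bold>*" 90)

datatype fm =
    Eq tm tm (infix "\<^bold>=" 70)
  | Less tm tm (infix "\<^bold><" 70)
  | Mem tm nat (infix "\<^bold>\<in>" 70)
  | Neg fm ("\<^bold>\<not> _" [60] 60)
  | And fm fm (infixr "\<^bold>\<and>" 55)
  | Or fm fm (infixr "\<^bold>\<or>" 50)
  | Imp fm fm (infixr "\<^bold>\<longrightarrow>" 45)
  | All nat fm
  | Ex nat fm
  | AllS nat fm
  | ExS nat fm

abbreviation Iff :: "fm \<Rightarrow> fm \<Rightarrow> fm" (infix "\<^bold>\<longleftrightarrow>" 40) where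
  "\<phi> \<^bold>\<longleftrightarrow> \<psi> \<equiv> (\<phi> \<^bold>\<longrightarrow> \<psi>) \<^bold>\<and> (\<psi> \<^bold>\<longrightarrow> \<phi>)"

fun tm_vars :: "tm \<Rightarrow> nat set" where
  "tm_vars (Var x) = {x}"
| "tm_vars Zero = {}"
| "tm_vars One = {}"
| "tm_vars (s \<^bold>+ t) = tm_vars s \<union> tm_vars t"
| "tm_vars (s \<^bold>* t) = tm_vars s \<union> tm_vars t"

fun free_sets :: "fm \<Rightarrow> nat set" where
  "free_sets (s \<^bold>= t) = {}"
| "free_sets (s \<^bold>< t) = {}"
| "free_sets (t \<^bold>\<in> X) = {X}"
| "free_sets (\<^bold>\<not> \<phi>) = free_sets \<phi>"
| "free_sets (\<phi> \<^bold>\<and> \<psi>) = free_sets \<phi> \<union> free_sets \<psi>"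
| "free_sets (\<phi> \<^bold>\<or> \<psi>) = free_sets \<phi> \<union> free_sets \<psi>"
| "free_sets (\<phi> \<^bold>\<longrightarrow> \<psi>) = free_sets \<phi> \<union> free_sets \<psi>"
| "free_sets (All x \<phi>) = free_sets \<phi>"
| "free_sets (Ex x \<phi>) = free_sets \<phi>"
| "free_sets (AllS X \<phi>) = free_sets \<phi> - {X}"
| "free_sets (ExS X \<phi>) = free_sets \<phi> - {X}"

fun tm_subst :: "nat \<Rightarrow> tm \<Rightarrow> tm \<Rightarrow> tm" where
  "tm_subst x r (Var y) = (if x = y then r else Var y)"
| "tm_subst x r Zero = Zero"
| "tm_subst x r One = One"
| "tm_subst x r (s \<^bold>+ t) = tm_subst x r s \<^bold>+ tm_subst x r t"
| "tm_subst x r (s \<^bold>* t) = tm_subst x r s \<^bold>* tm_subst x r t"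

text \<open>\<open>subst x r \<phi>\<close> replaces the free occurrences of \<open>x\<close> without renaming bound variables. It is
  used only when \<open>r\<close> contains no variable other than \<open>x\<close>, so that no capture can occur.\<close>

fun subst :: "nat \<Rightarrow> tm \<Rightarrow> fm \<Rightarrow> fm" where
  "subst x r (s \<^bold>= t) = (tm_subst x r s \<^bold>= tm_subst x r t)"
| "subst x r (s \<^bold>< t) = (tm_subst x r s \<^bold>< tm_subst x r t)"
| "subst x r (t \<^bold>\<in> X) = (tm_subst x r t \<^bold>\<in> X)"
| "subst x r (\<^bold>\<not> \<phi>) = (\<^bold>\<not> subst x r \<phi>)"
| "subst x r (\<phi> \<^bold>\<and> \<psi>) = (subst x r \<phi> \<^bold>\<and> subst x r \<psi>)"
| "subst x r (\<phi> \<^bold>\<or> \<psi>) = (subst x r \<phi> \<^bold>\<or> subst x r \<psi>)"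
| "subst x r (\<phi> \<^bold>\<longrightarrow> \<psi>) = (subst x r \<phi> \<^bold>\<longrightarrow> subst x r \<psi>)"
| "subst x r (All y \<phi>) = All y (if x = y then \<phi> else subst x r \<phi>)"
| "subst x r (Ex y \<phi>) = Ex y (if x = y then \<phi> else subst x r \<phi>)"
| "subst x r (AllS X \<phi>) = AllS X (subst x r \<phi>)"
| "subst x r (ExS X \<phi>) = ExS X (subst x r \<phi>)"

section \<open>Structures and satisfaction\<close>

text \<open>A structure has the whole type \<open>'a\<close> as its range of number variables and an arbitrary
  nonempty family \<open>Sets M\<close> of subsets of \<open>'a\<close> as its range of set variables. Neither part is
  assumed to be standard.\<close>

record 'a l2 =
  Sets :: "'a set set"
  zero :: 'a
  one :: 'a
  plus :: "'a \<Rightarrow> 'a \<Rightarrow> 'a"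
  times :: "'a \<Rightarrow> 'a \<Rightarrow> 'a"
  less :: "'a \<Rightarrow> 'a \<Rightarrow> bool"

definition l2_structure :: "'a l2 \<Rightarrow> bool" where
  "l2_structure M \<longleftrightarrow> Sets M \<noteq> {}"

fun val :: "'a l2 \<Rightarrow> (nat \<Rightarrow> 'a) \<Rightarrow> tm \<Rightarrow> 'a" where
  "val M e (Var x) = e x"
| "val M e Zero = zero M"
| "val M e One = one M"
| "val M e (s \<^bold>+ t) = plus M (val M e s) (val M e t)"
| "val M e (s \<^bold>* t) = times M (val M e s) (val M e t)"

fun sat :: "'a l2 \<Rightarrow> (nat \<Rightarrow> 'a) \<Rightarrow> (nat \<Rightarrow> 'a set) \<Rightarrow> fm \<Rightarrow> bool" where
  "sat M e S (s \<^bold>= t) \<longleftrightarrow> val M e s = val M e t"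
| "sat M e S (s \<^bold>< t) \<longleftrightarrow> less M (val M e s) (val M e t)"
| "sat M e S (t \<^bold>\<in> X) \<longleftrightarrow> val M e t \<in> S X"
| "sat M e S (\<^bold>\<not> \<phi>) \<longleftrightarrow> \<not> sat M e S \<phi>"
| "sat M e S (\<phi> \<^bold>\<and> \<psi>) \<longleftrightarrow> sat M e S \<phi> \<and> sat M e S \<psi>"
| "sat M e S (\<phi> \<^bold>\<or> \<psi>) \<longleftrightarrow> sat M e S \<phi> \<or> sat M e S \<psi>"
| "sat M e S (\<phi> \<^bold>\<longrightarrow> \<psi>) \<longleftrightarrow> (sat M e S \<phi> \<longrightarrow> sat M e S \<psi>)"
| "sat M e S (All x \<phi>) \<longleftrightarrow> (\<forall>a. sat M (e(x := a)) S \<phi>)"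
| "sat M e S (Ex x \<phi>) \<longleftrightarrow> (\<exists>a. sat M (e(x := a)) S \<phi>)"
| "sat M e S (AllS X \<phi>) \<longleftrightarrow> (\<forall>A\<in>Sets M. sat M e (S(X := A)) \<phi>)"
| "sat M e S (ExS X \<phi>) \<longleftrightarrow> (\<exists>A\<in>Sets M. sat M e (S(X := A)) \<phi>)"

text \<open>Free variables of an axiom are read as universally quantified.\<close>

definition models :: "'a l2 \<Rightarrow> fm set \<Rightarrow> bool" (infix "\<Turnstile>" 50) where
  "M \<Turnstile> T \<longleftrightarrow> (\<forall>\<phi>\<in>T. \<forall>e S. range S \<subseteq> Sets M \<longrightarrow> sat M e S \<phi>)"

section \<open>Classes of formulas\<close>

inductive bounded :: "fm \<Rightarrow> bool" where
  "bounded (s \<^bold>= t)"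
| "bounded (s \<^bold>< t)"
| "bounded (t \<^bold>\<in> X)"
| "bounded \<phi> \<Longrightarrow> bounded (\<^bold>\<not> \<phi>)"
| "bounded \<phi> \<Longrightarrow> bounded \<psi> \<Longrightarrow> bounded (\<phi> \<^bold>\<and> \<psi>)"
| "bounded \<phi> \<Longrightarrow> bounded \<psi> \<Longrightarrow> bounded (\<phi> \<^bold>\<or> \<psi>)"
| "bounded \<phi> \<Longrightarrow> bounded \<psi> \<Longrightarrow> bounded (\<phi> \<^bold>\<longrightarrow> \<psi>)"
| "bounded \<phi> \<Longrightarrow> x \<notin> tm_vars t \<Longrightarrow> bounded (All x (Var x \<^bold>< t \<^bold>\<longrightarrow> \<phi>))"
| "bounded \<phi> \<Longrightarrow> x \<notin> tm_vars t \<Longrightarrow> bounded (Ex x (Var x \<^bold>< t \<^bold>\<and> \<phi>))"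

definition sigma01 :: "fm \<Rightarrow> bool" where
  "sigma01 \<phi> \<longleftrightarrow> (\<exists>x \<theta>. \<phi> = Ex x \<theta> \<and> bounded \<theta>)"

definition pi01 :: "fm \<Rightarrow> bool" where
  "pi01 \<phi> \<longleftrightarrow> (\<exists>x \<theta>. \<phi> = All x \<theta> \<and> bounded \<theta>)"

fun arithmetical :: "fm \<Rightarrow> bool" where
  "arithmetical (s \<^bold>= t) = True"
| "arithmetical (s \<^bold>< t) = True"
| "arithmetical (t \<^bold>\<in> X) = True"
| "arithmetical (\<^bold>\<not> \<phi>) = arithmetical \<phi>"
| "arithmetical (\<phi> \<^bold>\<and> \<psi>) = (arithmetical \<phi> \<and> arithmetical \<psi>)"
| "arithmetical (\<phi> \<^bold>\<or> \<psi>) = (arithmetical \<phi> \<and> arithmetical \<psi>)"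
| "arithmetical (\<phi> \<^bold>\<longrightarrow> \<psi>) = (arithmetical \<phi> \<and> arithmetical \<psi>)"
| "arithmetical (All x \<phi>) = arithmetical \<phi>"
| "arithmetical (Ex x \<phi>) = arithmetical \<phi>"
| "arithmetical (AllS X \<phi>) = False"
| "arithmetical (ExS X \<phi>) = False"

section \<open>The axiom systems\<close>

definition basic_axioms :: "fm set" where
  "basic_axioms = (let m = Var 0; n = Var 1 in
    {\<^bold>\<not> (n \<^bold>+ One \<^bold>= Zero),
     m \<^bold>+ One \<^bold>= n \<^bold>+ One \<^bold>\<longrightarrow> m \<^bold>= n,
     m \<^bold>+ Zero \<^bold>= m,
     m \<^bold>+ (n \<^bold>+ One) \<^bold>= (m \<^bold>+ n) \<^bold>+ One,
     m \<^bold>* Zero \<^bold>= Zero,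
     m \<^bold>* (n \<^bold>+ One) \<^bold>= (m \<^bold>* n) \<^bold>+ m,
     \<^bold>\<not> (m \<^bold>< Zero),
     m \<^bold>< n \<^bold>+ One \<^bold>\<longleftrightarrow> (m \<^bold>< n \<^bold>\<or> m \<^bold>= n)})"

definition induction_axiom :: "nat \<Rightarrow> fm \<Rightarrow> fm" where
  "induction_axiom n \<phi> =
    (subst n Zero \<phi> \<^bold>\<and> All n (\<phi> \<^bold>\<longrightarrow> subst n (Var n \<^bold>+ One) \<phi>) \<^bold>\<longrightarrow> All n \<phi>)"

definition comprehension_axiom :: "nat \<Rightarrow> nat \<Rightarrow> fm \<Rightarrow> fm" where
  "comprehension_axiom X n \<phi> = ExS X (All n (Var n \<^bold>\<in> X \<^bold>\<longleftrightarrow> \<phi>))"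

definition RCA0 :: "fm set" where
  "RCA0 = basic_axioms
    \<union> {induction_axiom n \<phi> | n \<phi>. sigma01 \<phi>}
    \<union> {All n (\<phi> \<^bold>\<longleftrightarrow> \<psi>) \<^bold>\<longrightarrow> comprehension_axiom X n \<phi> | X n \<phi> \<psi>.
        sigma01 \<phi> \<and> pi01 \<psi> \<and> X \<notin> free_sets \<phi>}"

definition ACA0 :: "fm set" where
  "ACA0 = RCA0
    \<union> {comprehension_axiom X n \<phi> | X n \<phi>. arithmetical \<phi> \<and> X \<notin> free_sets \<phi>}"

section \<open>Sequences of graphs and colorings\<close>

text \<open>The usual pairing \<open>(s, t) = (s + t)\<^sup>2 + s\<close>, which is injective provably in \<open>RCA0\<close>.\<close>

definition pair :: "tm \<Rightarrow> tm \<Rightarrow> tm" where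
  "pair s t = (s \<^bold>+ t) \<^bold>* (s \<^bold>+ t) \<^bold>+ s"

text \<open>A set \<open>X\<close> codes the sequence of sets \<open>X\<^sub>i = {t. (i, t) \<in> X}\<close>.\<close>

definition mem_seq :: "tm \<Rightarrow> nat \<Rightarrow> tm \<Rightarrow> fm" where
  "mem_seq t X i = (pair i t \<^bold>\<in> X)"

text \<open>A sequence of graphs is given by the sequences of vertex sets \<open>V\<^sub>i\<close> and edge sets \<open>E\<^sub>i\<close>. The
  unordered pairs are coded by making \<open>E\<^sub>i\<close> a symmetric irreflexive subset of \<open>V\<^sub>i \<times> V\<^sub>i\<close>.
  Here and below the bound variables are chosen different from all the parameters.\<close>

definition is_graph :: "nat \<Rightarrow> nat \<Rightarrow> nat \<Rightarrow> fm" where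
  "is_graph V E i = (let p = i + 1; x = i + 2; y = i + 3 in
    All p (mem_seq (Var p) E (Var i) \<^bold>\<longrightarrow>
      Ex x (Ex y (Var p \<^bold>= pair (Var x) (Var y)
        \<^bold>\<and> mem_seq (Var x) V (Var i) \<^bold>\<and> mem_seq (Var y) V (Var i)
        \<^bold>\<and> \<^bold>\<not> (Var x \<^bold>= Var y)
        \<^bold>\<and> mem_seq (pair (Var y) (Var x)) E (Var i)))))"

text \<open>\<open>F\<close> is (the graph of) a function from \<open>{x. A x}\<close> to \<open>{y. B y}\<close>; the free number variables
  of \<open>A\<close> and \<open>B\<close>, apart from their argument, must be less than \<open>m\<close>.\<close>

definition is_function :: "nat \<Rightarrow> nat \<Rightarrow> (tm \<Rightarrow> fm) \<Rightarrow> (tm \<Rightarrow> fm) \<Rightarrow> fm" where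
  "is_function m F A B = (let p = m; x = m + 1; y = m + 2; z = m + 3 in
    All p (Var p \<^bold>\<in> F \<^bold>\<longrightarrow>
      Ex x (Ex y (Var p \<^bold>= pair (Var x) (Var y) \<^bold>\<and> A (Var x) \<^bold>\<and> B (Var y))))
    \<^bold>\<and> All x (A (Var x) \<^bold>\<longrightarrow> Ex y (pair (Var x) (Var y) \<^bold>\<in> F))
    \<^bold>\<and> All x (All y (All z
        (pair (Var x) (Var y) \<^bold>\<in> F \<^bold>\<and> pair (Var x) (Var z) \<^bold>\<in> F \<^bold>\<longrightarrow> Var y \<^bold>= Var z))))"

definition is_coloring :: "nat \<Rightarrow> nat \<Rightarrow> nat \<Rightarrow> nat \<Rightarrow> nat \<Rightarrow> fm" where
  "is_coloring C k V E i =
    (let m = i + k + 1; x = i + k + 1; y = i + k + 2; u = i + k + 3; v = i + k + 4 in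
    is_function m C (\<lambda>t. mem_seq t V (Var i)) (\<lambda>t. t \<^bold>< Var k)
    \<^bold>\<and> All x (All y (mem_seq (pair (Var x) (Var y)) E (Var i) \<^bold>\<longrightarrow>
        All u (All v (pair (Var x) (Var u) \<^bold>\<in> C \<^bold>\<and> pair (Var y) (Var v) \<^bold>\<in> C
          \<^bold>\<longrightarrow> \<^bold>\<not> (Var u \<^bold>= Var v))))))"

definition colorable :: "nat \<Rightarrow> nat \<Rightarrow> nat \<Rightarrow> fm" where
  "colorable V E i = (let k = i + 1; C = V + E + 1 in Ex k (ExS C (is_coloring C k V E i)))"

definition colorability_function_exists :: fm where
  "colorability_function_exists = (let V = 0; E = 1; F = 2; i = 0 in
    AllS V (AllS E (All i (is_graph V E i) \<^bold>\<longrightarrow>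
      ExS F (is_function 0 F (\<lambda>t. t \<^bold>= t) (\<lambda>t. t \<^bold>= Zero \<^bold>\<or> t \<^bold>= One)
        \<^bold>\<and> All i ((colorable V E i \<^bold>\<longrightarrow> pair (Var i) One \<^bold>\<in> F)
          \<^bold>\<and> (\<^bold>\<not> colorable V E i \<^bold>\<longrightarrow> pair (Var i) Zero \<^bold>\<in> F))))))"

end

theory Submission imports Defs begin

text \<open>From (2) to (1) it suffices to show that the projection \<open>{i. \<exists>j. (i, j) \<in> D}\<close> of a set exists.
  Let \<open>G\<^sub>i\<close> be the clique on all \<open>x\<close> with \<open>(i, j) \<in> D\<close> for some \<open>j < x\<close>. It has no edges if \<open>i\<close> is
  not in the projection, and is an infinite clique otherwise, which cannot be colored as there is no
  injection of a final segment of the numbers into \<open>{c. c < k}\<close>. The latter needs \<open>\<Sigma>\<^sup>0\<^sub>1\<close> induction: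
  replace the colors by pairwise coprime moduli and consider the largest value of the
  least common multiple of the moduli of finitely many points; it already accounts
  for all points, but the modulus of a fresh point is coprime to it.

  From (1) to (2), the graph \<open>G\<^sub>i\<close> is colorable iff for some \<open>k\<close> each of its finite initial
  segments has a \<open>k\<close>-coloring, by compactness. Finite sets are coded by divisibility by the same
  moduli, so the right-hand side is arithmetical. Compactness is proved with the leftmost path of
  the tree of finite colorings, which is arithmetically definable.\<close>

section \<open>Arithmetic in models of \<open>RCA0\<close>\<close>

fun fm_vars :: "fm \<Rightarrow> nat set" where
  "fm_vars (s \<^bold>= t) = tm_vars s \<union> tm_vars t"
| "fm_vars (s \<^bold>< t) = tm_vars s \<union> tm_vars t"
| "fm_vars (t \<^bold>\<in> X) = tm_vars t"
| "fm_vars (\<^bold>\<not> \<phi>) = fm_vars \<phi>"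
| "fm_vars (\<phi> \<^bold>\<and> \<psi>) = fm_vars \<phi> \<union> fm_vars \<psi>"
| "fm_vars (\<phi> \<^bold>\<or> \<psi>) = fm_vars \<phi> \<union> fm_vars \<psi>"
| "fm_vars (\<phi> \<^bold>\<longrightarrow> \<psi>) = fm_vars \<phi> \<union> fm_vars \<psi>"
| "fm_vars (All x \<phi>) = insert x (fm_vars \<phi>)"
| "fm_vars (Ex x \<phi>) = insert x (fm_vars \<phi>)"
| "fm_vars (AllS X \<phi>) = fm_vars \<phi>"
| "fm_vars (ExS X \<phi>) = fm_vars \<phi>"

lemma finite_tm_vars: "finite (tm_vars t)"
  by (induction t) auto

lemma finite_fm_vars: "finite (fm_vars \<phi>)"
  by (induction \<phi>) (auto simp: finite_tm_vars)

lemma finite_free_sets: "finite (free_sets \<phi>)"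
  by (induction \<phi>) auto

lemma val_cong: "(\<And>x. x \<in> tm_vars t \<Longrightarrow> e x = e' x) \<Longrightarrow> val M e t = val M e' t"
  by (induction t) auto

lemma sat_cong:
  "(\<And>x. x \<in> fm_vars \<phi> \<Longrightarrow> e x = e' x) \<Longrightarrow> (\<And>X. X \<in> free_sets \<phi> \<Longrightarrow> S X = S' X) \<Longrightarrow>
    sat M e S \<phi> = sat M e' S' \<phi>"
proof (induction \<phi> arbitrary: e e' S S')
  case (Eq s t)
  then show ?case using val_cong[of s e e' M] val_cong[of t e e' M] by simp
next
  case (Less s t)
  then show ?case using val_cong[of s e e' M] val_cong[of t e e' M] by simp
next
  case (Mem t X)
  then show ?case using val_cong[of t e e' M] by simp
next
  case (Neg \<phi>)
  show ?case using Neg.IH[of e e' S S'] Neg.prems by simp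
next
  case (And \<phi> \<psi>)
  show ?case using And.IH[of e e' S S'] And.prems by simp
next
  case (Or \<phi> \<psi>)
  show ?case using Or.IH[of e e' S S'] Or.prems by simp
next
  case (Imp \<phi> \<psi>)
  show ?case using Imp.IH[of e e' S S'] Imp.prems by simp
next
  case (All x \<phi>)
  have "sat M (e(x := a)) S \<phi> = sat M (e'(x := a)) S' \<phi>" for a
    by (rule All.IH) (use All.prems in auto)
  then show ?case by simp
next
  case (Ex x \<phi>)
  have "sat M (e(x := a)) S \<phi> = sat M (e'(x := a)) S' \<phi>" for a
    by (rule Ex.IH) (use Ex.prems in auto)
  then show ?case by simp
next
  case (AllS X \<phi>)
  have "sat M e (S(X := A)) \<phi> = sat M e' (S'(X := A)) \<phi>" for A
    by (rule AllS.IH) (use AllS.prems in auto)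
  then show ?case by simp
next
  case (ExS X \<phi>)
  have "sat M e (S(X := A)) \<phi> = sat M e' (S'(X := A)) \<phi>" for A
    by (rule ExS.IH) (use ExS.prems in auto)
  then show ?case by simp
qed

lemma val_tm_subst: "val M e (tm_subst x r t) = val M (e(x := val M e r)) t"
  by (induction t) auto

lemma val_update: "y \<notin> tm_vars t \<Longrightarrow> val M (e(y := a)) t = val M e t"
  by (rule val_cong) auto

text \<open>\<open>subst\<close> renames nothing, so \<open>r\<close> may mention at most
  \<open>x\<close>: below a quantifier over some \<open>y \<noteq> x\<close> the value of
  \<open>r\<close> then stays the same, and nothing is captured.\<close>

lemma sat_subst:
  "tm_vars r \<subseteq> {x} \<Longrightarrow> sat M e S (subst x r \<phi>) = sat M (e(x := val M e r)) S \<phi>"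
proof (induction \<phi> arbitrary: e S)
  case (All y \<phi>)
  show ?case
  proof (cases "x = y")
    case False
    have "sat M (e(y := a)) S (subst x r \<phi>) = sat M (e(x := val M e r, y := a)) S \<phi>" for a
    proof -
      have "val M (e(y := a)) r = val M e r" using False All.prems by (auto intro: val_update)
      then show ?thesis using All.IH[OF All.prems] fun_upd_twist[OF False] by metis
    qed
    then show ?thesis using False by (simp only: subst.simps sat.simps if_False)
  qed (simp only: subst.simps sat.simps fun_upd_upd simp_thms if_True)
next
  case (Ex y \<phi>)
  show ?case
  proof (cases "x = y")
    case False
    have "sat M (e(y := a)) S (subst x r \<phi>) = sat M (e(x := val M e r, y := a)) S \<phi>" for a
    proof -
      have "val M (e(y := a)) r = val M e r" using False Ex.prems by (auto intro: val_update)
      then show ?thesis using Ex.IH[OF Ex.prems] fun_upd_twist[OF False] by metis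
    qed
    then show ?thesis using False by (simp only: subst.simps sat.simps if_False)
  qed (simp only: subst.simps sat.simps fun_upd_upd simp_thms if_True)
qed (simp_all add: val_tm_subst)

section \<open>The axioms of \<open>RCA0\<close> as semantic rules\<close>

locale rca =
  fixes M :: "'a l2"
  assumes struct: "l2_structure M" and rca: "M \<Turnstile> RCA0"
begin

abbreviation zr ("\<zero>") where "\<zero> \<equiv> zero M"
abbreviation on ("\<one>") where "\<one> \<equiv> one M"
abbreviation pls (infixl "\<oplus>" 65) where "a \<oplus> b \<equiv> plus M a b"
abbreviation tms (infixl "\<otimes>" 70) where "a \<otimes> b \<equiv> times M a b"
abbreviation lss (infix "\<prec>" 50) where "a \<prec> b \<equiv> less M a b"

lemma Sets_nonempty: "\<exists>A. A \<in> Sets M"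
  using struct by (auto simp: l2_structure_def)

text \<open>The basic axioms contain no set variables, so one set assignment is as good as any
  other; nonemptiness of \<open>Sets M\<close> supplies one.\<close>

lemma basic_sat:
  assumes "\<phi> \<in> basic_axioms"
  shows "\<exists>S. sat M e S \<phi>"
proof -
  obtain A where "A \<in> Sets M" using Sets_nonempty by blast
  then have "range (\<lambda>_::nat. A) \<subseteq> Sets M" by auto
  then show ?thesis using rca assms unfolding models_def RCA0_def by blast
qed

lemma succ_ne_zero: "n \<oplus> \<one> \<noteq> \<zero>"
  and succ_inj: "m \<oplus> \<one> = n \<oplus> \<one> \<Longrightarrow> m = n"
  and plus_zero: "m \<oplus> \<zero> = m"
  and plus_succ: "m \<oplus> (n \<oplus> \<one>) = (m \<oplus> n) \<oplus> \<one>"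
  and times_zero: "m \<otimes> \<zero> = \<zero>"
  and times_succ: "m \<otimes> (n \<oplus> \<one>) = (m \<otimes> n) \<oplus> m"
  and not_less_zero: "\<not> m \<prec> \<zero>"
  and less_succ: "m \<prec> n \<oplus> \<one> \<longleftrightarrow> m \<prec> n \<or> m = n"
proof -
  have *: "\<forall>\<phi>\<in>basic_axioms. \<exists>S. sat M ((\<lambda>_. m)(1 := n)) S \<phi>"
    using basic_sat by blast
  from * show "n \<oplus> \<one> \<noteq> \<zero>" "m \<oplus> \<one> = n \<oplus> \<one> \<Longrightarrow> m = n" "m \<oplus> \<zero> = m"
    "m \<oplus> (n \<oplus> \<one>) = (m \<oplus> n) \<oplus> \<one>" "m \<otimes> \<zero> = \<zero>" "m \<otimes> (n \<oplus> \<one>) = (m \<otimes> n) \<oplus> m"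
    "\<not> m \<prec> \<zero>" "m \<prec> n \<oplus> \<one> \<longleftrightarrow> m \<prec> n \<or> m = n"
    by (auto simp: basic_axioms_def Let_def)
qed

text \<open>Wraps the axiom scheme so that an application only exhibits a defining formula, with
  parameters in \<open>e\<close> and \<open>S\<close>, and otherwise argues about the HOL predicate
  \<open>P\<close>.\<close>

lemma sigma_induct:
  assumes "bounded \<theta>" and S: "range S \<subseteq> Sets M"
    and P: "\<And>a. P a \<longleftrightarrow> (\<exists>b. sat M (e(n := a, x := b)) S \<theta>)"
    and "P \<zero>" and "\<And>a. P a \<Longrightarrow> P (a \<oplus> \<one>)"
  shows "P a"
proof -
  have "sigma01 (Ex x \<theta>)" using assms(1) by (auto simp: sigma01_def)
  then have "induction_axiom n (Ex x \<theta>) \<in> RCA0" by (auto simp: RCA0_def)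
  then have "sat M e S (induction_axiom n (Ex x \<theta>))" using rca S by (auto simp: models_def)
  \<comment> \<open>Every assignment reached through the substitutions and the quantifier over
    \<open>n\<close> differs from \<open>e\<close> at most at \<open>n\<close>.\<close>
  moreover have "sat M e' S (Ex x \<theta>) = P (e' n)" if "\<And>y. y \<noteq> n \<Longrightarrow> e' y = e y" for e'
  proof -
    have "e' = e(n := e' n)" using that by auto
    then show ?thesis using P[of "e' n"] by (metis sat.simps(9))
  qed
  ultimately show ?thesis using assms(4,5)
    by (simp add: induction_axiom_def sat_subst del: subst.simps sat.simps(9))
qed

text \<open>A vacuous existential quantifier over a fresh variable turns a bounded formula into a
  \<open>\<Sigma>\<^sup>0\<^sub>1\<close> formula.\<close>

lemma bounded_induct:
  assumes "bounded \<theta>" and S: "range S \<subseteq> Sets M"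
    and P: "\<And>a. P a \<longleftrightarrow> sat M (e(n := a)) S \<theta>"
    and "P \<zero>" and "\<And>a. P a \<Longrightarrow> P (a \<oplus> \<one>)"
  shows "P a"
proof -
  obtain x where x: "x \<notin> fm_vars \<theta>"
    using finite_fm_vars ex_new_if_finite infinite_UNIV_nat by blast
  have "sat M (e(n := a, x := b)) S \<theta> = sat M (e(n := a)) S \<theta>" for a b
    by (rule sat_cong) (use x in auto)
  then have "P a \<longleftrightarrow> (\<exists>b. sat M (e(n := a, x := b)) S \<theta>)" for a using P by simp
  from sigma_induct[OF assms(1,2) this assms(4,5)] show ?thesis .
qed

text \<open>Vacuous quantifiers over a fresh variable turn \<open>\<theta>\<close> into a
  \<open>\<Sigma>\<^sup>0\<^sub>1\<close> and a \<open>\<Pi>\<^sup>0\<^sub>1\<close> formula, whose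
  equivalence, as demanded by recursive comprehension, is then trivial.\<close>

lemma delta_comprehension:
  assumes "bounded \<theta>" and S: "range S \<subseteq> Sets M"
    and P: "\<And>a. P a \<longleftrightarrow> sat M (e(n := a)) S \<theta>"
  shows "Collect P \<in> Sets M"
proof -
  obtain x where x: "x \<notin> insert n (fm_vars \<theta>)"
    using finite_fm_vars ex_new_if_finite infinite_UNIV_nat by (metis finite_insert)
  obtain X where X: "X \<notin> free_sets \<theta>"
    using finite_free_sets ex_new_if_finite infinite_UNIV_nat by blast
  have [simp]: "sat M (e(n := a, x := b)) S \<theta> = P a" for a b
    unfolding P by (rule sat_cong) (use x in auto)
  have [simp]: "sat M (e(n := a, x := b)) (S(X := A)) \<theta> = P a" for a b A
    unfolding P by (rule sat_cong) (use x X in auto)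
  have "sigma01 (Ex x \<theta>)" "pi01 (All x \<theta>)" using assms(1) by (auto simp: sigma01_def pi01_def)
  then have "(All n (Ex x \<theta> \<^bold>\<longleftrightarrow> All x \<theta>) \<^bold>\<longrightarrow> comprehension_axiom X n (Ex x \<theta>)) \<in> RCA0"
    unfolding RCA0_def using X by (intro UnI2 CollectI exI[of _ X] exI[of _ n] exI[of _ "Ex x \<theta>"] exI[of _ "All x \<theta>"]) auto
  then have "sat M e S (All n (Ex x \<theta> \<^bold>\<longleftrightarrow> All x \<theta>) \<^bold>\<longrightarrow> comprehension_axiom X n (Ex x \<theta>))"
    using rca S by (auto simp: models_def)
  then obtain A where "A \<in> Sets M" "\<And>a. a \<in> A \<longleftrightarrow> P a"
    by (auto simp: comprehension_axiom_def)
  moreover from this have "Collect P = A" by auto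
  ultimately show ?thesis by simp
qed

lemma range_const: obtains S :: "nat \<Rightarrow> 'a set" where "range S \<subseteq> Sets M"
proof -
  obtain A where "A \<in> Sets M" using Sets_nonempty by blast
  then have "range (\<lambda>_::nat. A) \<subseteq> Sets M" by auto
  then show ?thesis by (rule that)
qed

lemma number_induct:
  assumes "bounded \<theta>" "\<And>S a. P a \<longleftrightarrow> sat M (e(n := a)) S \<theta>"
    and "P \<zero>" and "\<And>a. P a \<Longrightarrow> P (a \<oplus> \<one>)"
  shows "P a"
proof -
  obtain S :: "nat \<Rightarrow> 'a set" where "range S \<subseteq> Sets M" by (rule range_const)
  from bounded_induct[OF assms(1) this assms(2-4)] show ?thesis .
qed

section \<open>Semiring laws and the order\<close>

lemma plus_assoc: "(a \<oplus> b) \<oplus> c = a \<oplus> (b \<oplus> c)"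
  by (rule number_induct[where n = 2 and e = "(\<lambda>_. a)(1 := b)"
      and \<theta> = "(Var 0 \<^bold>+ Var 1) \<^bold>+ Var 2 \<^bold>= Var 0 \<^bold>+ (Var 1 \<^bold>+ Var 2)" and a = c])
    (auto intro: bounded.intros simp: plus_zero plus_succ)

lemma zero_plus: "\<zero> \<oplus> a = a"
  by (rule number_induct[where n = 0 and \<theta> = "Zero \<^bold>+ Var 0 \<^bold>= Var 0" and a = a])
    (auto intro: bounded.intros simp: plus_zero plus_succ)

lemma times_one: "a \<otimes> \<one> = a"
  using times_succ[of a \<zero>] by (metis zero_plus times_zero)

lemma one_plus: "\<one> \<oplus> a = a \<oplus> \<one>"
  by (rule number_induct[where n = 0 and \<theta> = "One \<^bold>+ Var 0 \<^bold>= Var 0 \<^bold>+ One" and a = a])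
    (auto intro: bounded.intros simp: plus_zero plus_succ zero_plus)

lemma plus_comm: "a \<oplus> b = b \<oplus> a"
proof (rule number_induct[where n = 0 and e = "\<lambda>_. a" and \<theta> = "Var 1 \<^bold>+ Var 0 \<^bold>= Var 0 \<^bold>+ Var 1" and a = b])
  fix b assume "a \<oplus> b = b \<oplus> a"
  then show "a \<oplus> (b \<oplus> \<one>) = b \<oplus> \<one> \<oplus> a" by (metis one_plus plus_assoc)
qed (auto intro: bounded.intros simp: plus_zero zero_plus)

lemma plus_left_comm: "a \<oplus> (b \<oplus> c) = b \<oplus> (a \<oplus> c)"
  by (metis plus_assoc plus_comm)

lemmas plus_ac = plus_assoc plus_comm plus_left_comm

lemma plus_cancel: "a \<oplus> c = b \<oplus> c \<Longrightarrow> a = b"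
proof -
  have "a \<oplus> c = b \<oplus> c \<longrightarrow> a = b"
    by (rule number_induct[where n = 2 and e = "(\<lambda>_. a)(1 := b)"
      and \<theta> = "Var 0 \<^bold>+ Var 2 \<^bold>= Var 1 \<^bold>+ Var 2 \<^bold>\<longrightarrow> Var 0 \<^bold>= Var 1" and a = c])
    (auto intro: bounded.intros simp: plus_zero plus_succ dest: succ_inj)
  then show "a \<oplus> c = b \<oplus> c \<Longrightarrow> a = b" by blast
qed

lemma times_plus: "a \<otimes> (b \<oplus> c) = a \<otimes> b \<oplus> a \<otimes> c"
  by (rule number_induct[where n = 2 and e = "(\<lambda>_. a)(1 := b)"
      and \<theta> = "Var 0 \<^bold>* (Var 1 \<^bold>+ Var 2) \<^bold>= Var 0 \<^bold>* Var 1 \<^bold>+ Var 0 \<^bold>* Var 2" and a = c])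
    (auto intro: bounded.intros simp: plus_zero times_zero times_succ simp flip: plus_assoc)

lemma times_assoc: "(a \<otimes> b) \<otimes> c = a \<otimes> (b \<otimes> c)"
  by (rule number_induct[where n = 2 and e = "(\<lambda>_. a)(1 := b)"
      and \<theta> = "(Var 0 \<^bold>* Var 1) \<^bold>* Var 2 \<^bold>= Var 0 \<^bold>* (Var 1 \<^bold>* Var 2)" and a = c])
    (auto intro: bounded.intros simp: times_zero times_one times_plus)

lemma zero_times: "\<zero> \<otimes> a = \<zero>"
  by (rule number_induct[where n = 0 and \<theta> = "Zero \<^bold>* Var 0 \<^bold>= Zero" and a = a])
    (auto intro: bounded.intros simp: plus_zero times_zero times_succ)

lemma succ_times: "(b \<oplus> \<one>) \<otimes> a = b \<otimes> a \<oplus> a"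
proof (rule number_induct[where n = 0 and e = "\<lambda>_. b"
      and \<theta> = "(Var 1 \<^bold>+ One) \<^bold>* Var 0 \<^bold>= Var 1 \<^bold>* Var 0 \<^bold>+ Var 0" and a = a])
  fix a assume "(b \<oplus> \<one>) \<otimes> a = b \<otimes> a \<oplus> a"
  then show "(b \<oplus> \<one>) \<otimes> (a \<oplus> \<one>) = b \<otimes> (a \<oplus> \<one>) \<oplus> (a \<oplus> \<one>)"
    by (simp add: times_succ plus_ac)
qed (auto intro: bounded.intros simp: plus_zero times_zero)

lemma times_comm: "a \<otimes> b = b \<otimes> a"
  by (rule number_induct[where n = 0 and e = "\<lambda>_. a" and \<theta> = "Var 1 \<^bold>* Var 0 \<^bold>= Var 0 \<^bold>* Var 1" and a = b])
   (auto intro: bounded.intros simp: times_zero zero_times times_succ succ_times)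

lemma zero_or_succ: "a = \<zero> \<or> (\<exists>b. a = b \<oplus> \<one>)"
proof -
  obtain S :: "nat \<Rightarrow> 'a set" where S: "range S \<subseteq> Sets M" by (rule range_const)
  show ?thesis
    by (rule sigma_induct[where n = 0 and x = 1 and \<theta> = "Var 0 \<^bold>= Zero \<^bold>\<or> Var 0 \<^bold>= Var 1 \<^bold>+ One" and a = a, OF _ S])
      (auto intro: bounded.intros)
qed

text \<open>The axioms describe \<open>\<prec>\<close> only at zero and at successors. Induction on
  \<open>b\<close> in one direction and on \<open>d\<close> in the other identifies it with the
  additive order, from which the order properties are then derived.\<close>

lemma less_iff: "a \<prec> b \<longleftrightarrow> (\<exists>d. b = a \<oplus> d \<oplus> \<one>)"
proof
  obtain S :: "nat \<Rightarrow> 'a set" where S: "range S \<subseteq> Sets M" by (rule range_const)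
  have "a \<prec> b \<longrightarrow> (\<exists>d. b = a \<oplus> d \<oplus> \<one>)"
  proof (rule sigma_induct[where n = 0 and x = 1 and e = "\<lambda>_. a"
        and \<theta> = "Var 2 \<^bold>< Var 0 \<^bold>\<longrightarrow> Var 0 \<^bold>= Var 2 \<^bold>+ Var 1 \<^bold>+ One" and a = b, OF _ S])
    fix b assume "a \<prec> b \<longrightarrow> (\<exists>d. b = a \<oplus> d \<oplus> \<one>)"
    then show "a \<prec> b \<oplus> \<one> \<longrightarrow> (\<exists>d. b \<oplus> \<one> = a \<oplus> d \<oplus> \<one>)"
      by (metis less_succ plus_assoc plus_zero)
  qed (auto intro: bounded.intros simp: not_less_zero)
  then show "a \<prec> b \<Longrightarrow> \<exists>d. b = a \<oplus> d \<oplus> \<one>" by blast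
next
  have "a \<prec> a \<oplus> d \<oplus> \<one>" for d
    by (rule number_induct[where n = 0 and e = "\<lambda>_. a"
        and \<theta> = "Var 1 \<^bold>< Var 1 \<^bold>+ Var 0 \<^bold>+ One" and a = d])
      (auto intro: bounded.intros simp: plus_zero plus_succ less_succ)
  then show "\<exists>d. b = a \<oplus> d \<oplus> \<one> \<Longrightarrow> a \<prec> b" by blast
qed

lemma less_total: "a \<prec> b \<or> a = b \<or> b \<prec> a"
proof (rule number_induct[where n = 0 and e = "\<lambda>_. a"
      and \<theta> = "Var 1 \<^bold>< Var 0 \<^bold>\<or> Var 1 \<^bold>= Var 0 \<^bold>\<or> Var 0 \<^bold>< Var 1" and a = b])
  show "a \<prec> \<zero> \<or> a = \<zero> \<or> \<zero> \<prec> a"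
    using zero_or_succ[of a] by (auto simp: less_iff zero_plus)
next
  fix b assume *: "a \<prec> b \<or> a = b \<or> b \<prec> a"
  have "a = b \<oplus> \<one> \<or> b \<oplus> \<one> \<prec> a" if "b \<prec> a"
  proof -
    obtain d where d: "a = b \<oplus> d \<oplus> \<one>" using \<open>b \<prec> a\<close> less_iff by blast
    then show ?thesis using zero_or_succ[of d]
      by (auto simp: less_iff plus_zero zero_plus plus_ac)
  qed
  with * show "a \<prec> b \<oplus> \<one> \<or> a = b \<oplus> \<one> \<or> b \<oplus> \<one> \<prec> a" by (auto simp: less_succ)
qed (auto intro: bounded.intros)

lemma not_less_self: "\<not> a \<prec> a"
proof
  assume "a \<prec> a"
  then obtain d where "a = a \<oplus> d \<oplus> \<one>" using less_iff by blast
  then have "\<zero> \<oplus> a = (d \<oplus> \<one>) \<oplus> a" by (metis zero_plus plus_assoc plus_comm)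
  then show False using plus_cancel succ_ne_zero by metis
qed

lemma less_transitive: "a \<prec> b \<Longrightarrow> b \<prec> c \<Longrightarrow> a \<prec> c"
  unfolding less_iff by (metis plus_assoc)

definition le (infix "\<preceq>" 50) where "a \<preceq> b \<longleftrightarrow> a \<prec> b \<or> a = b"

text \<open>The language has no subtraction; this truncated version supplies the operation that
  \<open>linordered_semidom\<close> asks for below.\<close>

definition diff (infixl "\<ominus>" 65) where "a \<ominus> b = (if b \<preceq> a then THE d. b \<oplus> d = a else \<zero>)"

lemma le_iff: "a \<preceq> b \<longleftrightarrow> (\<exists>d. b = a \<oplus> d)"
proof -
  have "(\<exists>d. b = a \<oplus> d) \<longleftrightarrow> (\<exists>d. b = a \<oplus> d \<oplus> \<one>) \<or> a = b"
    by (metis plus_assoc plus_zero zero_or_succ)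
  then show ?thesis by (auto simp: le_def less_iff)
qed

lemma diff_plus: "(a \<oplus> d) \<ominus> a = d"
proof -
  have "a \<preceq> a \<oplus> d" by (auto simp: le_iff)
  moreover have "(THE d'. a \<oplus> d' = a \<oplus> d) = d"
    by (rule the_equality) (use plus_cancel plus_comm in metis)+
  ultimately show ?thesis by (simp add: diff_def)
qed

lemma diff_not_le: "\<not> b \<preceq> a \<Longrightarrow> a \<ominus> b = \<zero>"
  by (simp add: diff_def)

lemma less_times: "a \<prec> b \<Longrightarrow> \<zero> \<prec> c \<Longrightarrow> c \<otimes> a \<prec> c \<otimes> b"
proof -
  assume "a \<prec> b" "\<zero> \<prec> c"
  then obtain d u where "b = a \<oplus> d \<oplus> \<one>" and "c = u \<oplus> \<one>" by (auto simp: less_iff zero_plus)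
  then have "c \<otimes> b = c \<otimes> a \<oplus> (c \<otimes> d \<oplus> u) \<oplus> \<one>"
    by (simp add: times_plus times_one plus_assoc)
  then show ?thesis using less_iff by blast
qed

lemma zero_below_one: "\<zero> \<prec> \<one>"
  using less_iff[of \<zero> \<one>] by (metis zero_plus)

lemma diff_diff_eq_plus: "a \<ominus> b \<ominus> c = a \<ominus> (b \<oplus> c)"
proof (cases "b \<oplus> c \<preceq> a")
  case True
  then obtain d where "a = b \<oplus> (c \<oplus> d)" by (auto simp: le_iff plus_assoc)
  then show ?thesis by (metis diff_plus plus_assoc)
next
  case False
  have "a \<ominus> b \<ominus> c = \<zero>"
  proof (cases "b \<preceq> a")
    case True
    then obtain d where d: "a = b \<oplus> d" by (auto simp: le_iff)
    have "\<not> c \<preceq> d" using False d by (auto simp: le_iff plus_assoc)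
    then show ?thesis by (simp add: d diff_plus diff_not_le)
  next
    case False
    then have "a \<ominus> b = \<zero>" by (rule diff_not_le)
    moreover have "\<zero> \<ominus> c = \<zero>"
      by (cases "c = \<zero>") (use diff_plus[of \<zero> \<zero>] in \<open>auto simp: zero_plus diff_def le_def not_less_zero\<close>)
    ultimately show ?thesis by simp
  qed
  then show ?thesis using False diff_not_le by simp
qed

text \<open>Makes the library facts on ordered semirings and divisibility available for the numbers
  of \<open>M\<close>, which may be nonstandard.\<close>

sublocale linordered_semidom "plus M" diff le "less M" "zero M" "times M" "one M"
proof unfold_locales
  fix a b c
  show "(a \<prec> b) = (a \<preceq> b \<and> \<not> b \<preceq> a)"
    using not_less_self less_transitive by (auto simp: le_def)
  show "a \<preceq> b \<Longrightarrow> b \<preceq> c \<Longrightarrow> a \<preceq> c" using less_transitive by (auto simp: le_def)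
  show "a \<preceq> b \<Longrightarrow> b \<preceq> a \<Longrightarrow> a = b" using not_less_self less_transitive by (auto simp: le_def)
  show "a \<preceq> b \<or> b \<preceq> a" using less_total by (auto simp: le_def)
  show "a \<preceq> b \<Longrightarrow> c \<oplus> a \<preceq> c \<oplus> b" by (auto simp: le_iff plus_assoc)
  show "\<zero> \<noteq> \<one>" using zero_below_one not_less_self by auto
  show "a \<noteq> \<zero> \<Longrightarrow> b \<noteq> \<zero> \<Longrightarrow> a \<otimes> b \<noteq> \<zero>"
    by (metis less_times less_total not_less_zero times_zero)
  show "b \<preceq> a \<Longrightarrow> a \<ominus> b \<oplus> b = a" by (metis le_iff diff_plus plus_comm)
  show "(a \<oplus> b) \<otimes> c = a \<otimes> c \<oplus> b \<otimes> c" by (metis times_comm times_plus)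
  show "a \<preceq> a" by (simp add: le_def)
  show "\<one> \<otimes> a = a" by (metis times_one times_comm)
  show "a \<otimes> (b \<ominus> c) = a \<otimes> b \<ominus> a \<otimes> c"
  proof (cases "c \<preceq> b")
    case True
    then show ?thesis by (metis le_iff diff_plus times_plus)
  next
    case False
    then have "b \<prec> c" using less_total by (auto simp: le_def)
    have "a \<otimes> b \<ominus> a \<otimes> c = \<zero>"
    proof (cases "\<zero> \<prec> a")
      case True
      then have "a \<otimes> b \<prec> a \<otimes> c" using \<open>b \<prec> c\<close> less_times by blast
      then have "\<not> a \<otimes> c \<preceq> a \<otimes> b" using less_transitive not_less_self by (auto simp: le_def)
      then show ?thesis by (rule diff_not_le)
    next
      case False
      then have "a = \<zero>" using less_total not_less_zero by blast
      then show ?thesis using diff_plus[of \<zero> \<zero>] by (simp add: zero_times plus_zero)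
    qed
    then show ?thesis using False by (simp add: diff_not_le times_zero)
  qed
qed (fact plus_assoc plus_comm zero_plus times_assoc times_comm zero_times times_zero times_plus diff_plus diff_diff_eq_plus
  zero_below_one | erule (1) less_times)+

end

section \<open>Coprime moduli and coding of finite sets\<close>

text \<open>A quotient can always be chosen at most \<open>t\<close>, which keeps divisibility a
  bounded formula. The bound variable is an argument so that each use can avoid clashes.\<close>

definition dvd_fm :: "nat \<Rightarrow> tm \<Rightarrow> tm \<Rightarrow> fm" where
  "dvd_fm x s t = Ex x (Var x \<^bold>< t \<^bold>+ One \<^bold>\<and> t \<^bold>= s \<^bold>* Var x)"

lemma bounded_dvd_fm: "x \<notin> tm_vars t \<Longrightarrow> bounded (dvd_fm x s t)"
  unfolding dvd_fm_def by (auto intro!: bounded.intros)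

lemma arithmetical_dvd_fm [simp]: "arithmetical (dvd_fm x s t)"
  by (simp add: dvd_fm_def)

text \<open>These are the moduli of Goedel's beta function.\<close>

definition modulus_tm :: "tm \<Rightarrow> tm \<Rightarrow> tm" where
  "modulus_tm l z = One \<^bold>+ (z \<^bold>+ One) \<^bold>* l"

lemma tm_vars_modulus_tm [simp]: "tm_vars (modulus_tm l z) = tm_vars l \<union> tm_vars z"
  by (auto simp: modulus_tm_def)

lemma tm_vars_pair [simp]: "tm_vars (pair s t) = tm_vars s \<union> tm_vars t"
  by (auto simp: pair_def)

section \<open>Pairing, divisibility and moduli inside a model\<close>

context rca
begin

abbreviation divides (infix "dvds" 50) where "divides \<equiv> dvd.dvd (times M)"

definition pr where "pr s t = (s \<oplus> t) \<otimes> (s \<oplus> t) \<oplus> s"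

definition modulus where "modulus l z = \<one> \<oplus> (z \<oplus> \<one>) \<otimes> l"

lemma val_pair [simp]: "val M e (pair s t) = pr (val M e s) (val M e t)"
  by (simp add: pair_def pr_def)

lemma val_modulus_tm [simp]: "val M e (modulus_tm s t) = modulus (val M e s) (val M e t)"
  by (simp add: modulus_tm_def modulus_def)

lemma less_iff_succ_le: "a \<prec> b \<longleftrightarrow> a \<oplus> \<one> \<preceq> b"
  using less_succ[of b a] not_less less_le by auto

lemma less_succ_iff_le: "a \<prec> b \<oplus> \<one> \<longleftrightarrow> a \<preceq> b"
  using less_succ le_def by simp

lemma zero_le: "\<zero> \<preceq> a"
  using le_iff zero_plus by metis

lemma le_times: "\<zero> \<prec> a \<Longrightarrow> b \<preceq> a \<otimes> b"
  using mult_right_mono[of \<one> a b] less_iff_succ_le[of \<zero> a] zero_le by (simp add: zero_plus)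

text \<open>Quantifiers over the components of a pair can therefore be bounded by its code.\<close>

lemma le_pr: "s \<preceq> pr s t" "t \<preceq> pr s t"
proof -
  show "s \<preceq> pr s t" unfolding pr_def using zero_le by simp
  have "s \<oplus> t \<preceq> (s \<oplus> t) \<otimes> (s \<oplus> t)"
    using le_times[of "s \<oplus> t" "s \<oplus> t"] zero_le le_less by fastforce
  moreover have "t \<preceq> s \<oplus> t" "(s \<oplus> t) \<otimes> (s \<oplus> t) \<preceq> pr s t" using zero_le by (auto simp: pr_def)
  ultimately show "t \<preceq> pr s t" using order_trans by blast
qed

text \<open>With \<open>n\<close> for the sum \<open>s + t\<close>, the code lies between the square
  of \<open>n\<close> and that square plus \<open>n\<close>, hence before the square of
  \<open>n + 1\<close>. So codes of pairs with different sums never meet, which yields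
  injectivity.\<close>

lemma pr_less: "s \<oplus> t \<prec> s' \<oplus> t' \<Longrightarrow> pr s t \<prec> pr s' t'"
proof -
  assume "s \<oplus> t \<prec> s' \<oplus> t'"
  then have *: "s \<oplus> t \<oplus> \<one> \<preceq> s' \<oplus> t'" by (simp add: less_iff_succ_le)
  have "pr s t \<preceq> (s \<oplus> t) \<otimes> (s \<oplus> t) \<oplus> (s \<oplus> t)" using zero_le by (simp add: pr_def)
  also have "\<dots> = (s \<oplus> t) \<otimes> (s \<oplus> t \<oplus> \<one>)" by (simp add: times_succ)
  also have "\<dots> \<prec> (s \<oplus> t \<oplus> \<one>) \<otimes> (s \<oplus> t \<oplus> \<one>)"
    by (rule mult_strict_right_mono) (auto simp: less_succ_iff_le zero_le)
  also have "\<dots> \<preceq> (s' \<oplus> t') \<otimes> (s' \<oplus> t')" using * by (intro mult_mono) (auto simp: zero_le)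
  also have "\<dots> \<preceq> pr s' t'" using zero_le by (simp add: pr_def)
  finally show ?thesis .
qed

lemma pr_eq_iff [simp]: "pr s t = pr s' t' \<longleftrightarrow> s = s' \<and> t = t'"
proof
  assume eq: "pr s t = pr s' t'"
  then have "s \<oplus> t = s' \<oplus> t'" using pr_less less_total not_less_self by metis
  moreover from this have "s = s'" using eq by (simp add: pr_def)
  ultimately show "s = s' \<and> t = t'" by simp
qed simp

lemma divides_iff: "a dvds b \<longleftrightarrow> (\<exists>q. b = a \<otimes> q)"
  by (simp add: dvd.dvd_def)

lemma divides_iff_bounded: "a dvds b \<longleftrightarrow> (\<exists>q. q \<prec> b \<oplus> \<one> \<and> b = a \<otimes> q)"
proof
  assume "a dvds b"
  then obtain q where q: "b = a \<otimes> q" by (auto simp: divides_iff)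
  show "\<exists>q. q \<prec> b \<oplus> \<one> \<and> b = a \<otimes> q"
  proof (cases "a = \<zero>")
    case True
    \<comment> \<open>If \<open>a\<close> is zero, then so is \<open>b\<close>, and the given
      quotient is arbitrary and may be too large; zero is a quotient within the bound.\<close>
    then show ?thesis using q by (intro exI[of _ \<zero>]) (auto simp: less_succ_iff_le)
  next
    case False
    then show ?thesis using q le_times[of a q] zero_le le_less less_succ_iff_le by metis
  qed
qed (auto simp: divides_iff)

lemma sat_dvd_fm [simp]:
  assumes "x \<notin> tm_vars s" "x \<notin> tm_vars t"
  shows "sat M e S (dvd_fm x s t) \<longleftrightarrow> val M e s dvds val M e t"
  using assms by (simp add: dvd_fm_def divides_iff_bounded val_update)

text \<open>Stands in for factorials and finite products. With \<open>r\<close> zero and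
  \<open>l\<close> one it gives a common multiple of the numbers from one to \<open>k\<close>; with
  \<open>r\<close> one it gives a common multiple of the first \<open>k\<close> moduli.\<close>

lemma ex_common_multiple: "\<exists>t. \<zero> \<prec> t \<and> (\<forall>z. z \<prec> k \<longrightarrow> (\<one> \<oplus> (z \<oplus> r) \<otimes> l) dvds t)"
proof -
  obtain S :: "nat \<Rightarrow> 'a set" where S: "range S \<subseteq> Sets M" by (rule range_const)
  show ?thesis
  proof (rule sigma_induct[where n = 0 and x = 1 and a = k and e = "(\<lambda>_. l)(2 := r)", OF _ S])
    show "bounded (Zero \<^bold>< Var 1 \<^bold>\<and>
      All 4 (Var 4 \<^bold>< Var 0 \<^bold>\<longrightarrow> dvd_fm 5 (One \<^bold>+ (Var 4 \<^bold>+ Var 2) \<^bold>* Var 3) (Var 1)))"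
      by (auto intro!: bounded.intros bounded_dvd_fm)
  next
    show "\<exists>t. \<zero> \<prec> t \<and> (\<forall>z. z \<prec> \<zero> \<longrightarrow> (\<one> \<oplus> (z \<oplus> r) \<otimes> l) dvds t)"
      using zero_below_one not_less_zero by blast
  next
    fix k assume "\<exists>t. \<zero> \<prec> t \<and> (\<forall>z. z \<prec> k \<longrightarrow> (\<one> \<oplus> (z \<oplus> r) \<otimes> l) dvds t)"
    then obtain t where t: "\<zero> \<prec> t" "\<And>z. z \<prec> k \<Longrightarrow> (\<one> \<oplus> (z \<oplus> r) \<otimes> l) dvds t" by blast
    have "\<zero> \<prec> \<one> \<oplus> (k \<oplus> r) \<otimes> l"
      using zero_below_one zero_le by (simp add: add_pos_nonneg)
    then have "\<zero> \<prec> (\<one> \<oplus> (k \<oplus> r) \<otimes> l) \<otimes> t" using t(1) by simp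
    then show "\<exists>t. \<zero> \<prec> t \<and> (\<forall>z. z \<prec> k \<oplus> \<one> \<longrightarrow> (\<one> \<oplus> (z \<oplus> r) \<otimes> l) dvds t)"
      \<comment> \<open>The witness is the old multiple times the new factor.\<close>
      using t(2) by (intro exI[of _ "(\<one> \<oplus> (k \<oplus> r) \<otimes> l) \<otimes> t"]) (auto simp: less_succ)
  qed simp
qed

text \<open>The condition from Goedel's beta lemma: it makes the moduli with indices below
  \<open>b\<close> pairwise coprime.\<close>

definition good where "good l b \<longleftrightarrow> \<zero> \<prec> l \<and> (\<forall>w. w \<prec> b \<longrightarrow> (w \<oplus> \<one>) dvds l)"

lemma ex_good: "\<exists>l. good l b"
  using ex_common_multiple[of b \<zero> \<one>] by (simp add: good_def add_commute)

text \<open>Modulo \<open>modulus l c\<close> the product \<open>(c + 1) l\<close> is minus one, so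
  \<open>l\<close> is invertible and can be cancelled.\<close>

lemma modulus_dvd_cancel:
  assumes "modulus l c dvds l \<otimes> y"
  shows "modulus l c dvds y"
proof -
  have "modulus l c dvds (c \<oplus> \<one>) \<otimes> (l \<otimes> y)" using assms by (rule dvd_mult)
  moreover have "modulus l c \<otimes> y = (c \<oplus> \<one>) \<otimes> (l \<otimes> y) \<oplus> y"
    by (simp add: modulus_def algebra_simps)
  ultimately show ?thesis using dvd_add_right_iff dvd_triv_left by metis
qed

text \<open>Coprimality in Euclid's form, which avoids greatest common divisors. The difference of
  the two moduli is \<open>(w + 1) l\<close> for some \<open>w\<close> below \<open>b\<close>, so
  the modulus divides \<open>(w + 1) l q\<close>. Here \<open>l\<close> cancels; multiplying by the
  cofactor of \<open>w + 1\<close> in \<open>l\<close> leaves \<open>l q\<close>, and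
  \<open>l\<close> cancels once more.\<close>

lemma modulus_coprime:
  assumes "good l b" "c \<prec> b" "c' \<prec> b" "c \<noteq> c'" and dvd: "modulus l c dvds modulus l c' \<otimes> q"
  shows "modulus l c dvds q"
proof -
  have step: "modulus l c dvds q" if w: "(w \<oplus> \<one>) dvds l" "modulus l c dvds (w \<oplus> \<one>) \<otimes> l \<otimes> q" for w
  proof -
    obtain v where v: "l = (w \<oplus> \<one>) \<otimes> v" using w(1) unfolding divides_iff by blast
    have "modulus l c dvds l \<otimes> ((w \<oplus> \<one>) \<otimes> q)" using w(2) by (simp add: mult_ac)
    then have "modulus l c dvds (w \<oplus> \<one>) \<otimes> q" by (rule modulus_dvd_cancel)
    then have "modulus l c dvds v \<otimes> ((w \<oplus> \<one>) \<otimes> q)" by (rule dvd_mult)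
    moreover have "v \<otimes> ((w \<oplus> \<one>) \<otimes> q) = l \<otimes> q"
      by (metis v mult_assoc mult_commute)
    ultimately show ?thesis using modulus_dvd_cancel by metis
  qed
  from \<open>c \<noteq> c'\<close> consider w where "c' = c \<oplus> w \<oplus> \<one>" | w where "c = c' \<oplus> w \<oplus> \<one>"
    using less_total less_iff by metis
  then show ?thesis
  proof cases
    case 1
    then have "w \<preceq> c'" using le_iff by (metis plus_assoc plus_comm)
    then have "(w \<oplus> \<one>) dvds l" using assms by (auto simp: good_def)
    moreover have "modulus l c' \<otimes> q = modulus l c \<otimes> q \<oplus> (w \<oplus> \<one>) \<otimes> l \<otimes> q"
      by (simp add: 1 modulus_def algebra_simps del: one_add_one)
    ultimately show ?thesis using step dvd dvd_add_right_iff dvd_triv_left by metis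
  next
    case 2
    then have "w \<preceq> c" using le_iff by (metis plus_assoc plus_comm)
    then have "(w \<oplus> \<one>) dvds l" using assms by (auto simp: good_def)
    moreover have "modulus l c \<otimes> q = modulus l c' \<otimes> q \<oplus> (w \<oplus> \<one>) \<otimes> l \<otimes> q"
      by (simp add: 2 modulus_def algebra_simps del: one_add_one)
    ultimately show ?thesis using step dvd dvd_add_right_iff dvd_triv_left by metis
  qed
qed

lemma one_less_modulus: "good l b \<Longrightarrow> \<one> \<prec> modulus l c"
  unfolding good_def modulus_def
  by (metis less_add_same_cancel1 mult_pos_pos less_succ_iff_le zero_le)

section \<open>Finite sets coded by divisibility, and the pigeonhole principle\<close>

definition coded where "coded l n = {z. modulus l z dvds n}"

lemma mem_coded: "z \<in> coded l n \<longleftrightarrow> modulus l z dvds n"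
  by (simp add: coded_def)

text \<open>The elements of \<open>A\<close> are inserted one at a time: multiplying
  \<open>n\<close> by the modulus of \<open>j\<close> adds \<open>j\<close> and, by coprimality, no
  other number below \<open>b\<close>. Coprimality is guaranteed only below \<open>b\<close>, so
  indices \<open>j\<close> from \<open>b\<close> on are skipped.\<close>

lemma ex_coded:
  assumes A: "A \<in> Sets M"
  shows "\<exists>l n. \<forall>x. x \<prec> b \<longrightarrow> (x \<in> coded l n \<longleftrightarrow> x \<in> A)"
proof -
  obtain l where l: "good l b" using ex_good by blast
  have "\<exists>n. \<forall>x. x \<prec> b \<longrightarrow> (modulus l x dvds n \<longleftrightarrow> x \<in> A \<and> x \<prec> j)" for j
  proof (rule sigma_induct[where n = 0 and x = 1 and a = j and e = "(\<lambda>_. l)(2 := b)" and S = "\<lambda>_. A"])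
    show "bounded (All 4 (Var 4 \<^bold>< Var 2 \<^bold>\<longrightarrow>
        (dvd_fm 5 (modulus_tm (Var 3) (Var 4)) (Var 1) \<^bold>\<longleftrightarrow> Var 4 \<^bold>\<in> 0 \<^bold>\<and> Var 4 \<^bold>< Var 0)))"
      by (intro bounded.intros bounded_dvd_fm) auto
  next
    \<comment> \<open>The induction starts with \<open>n\<close> equal to one, which codes the empty
      set.\<close>
    have "\<not> modulus l x dvds \<one>" for x
    proof
      assume "modulus l x dvds \<one>"
      then obtain q where q: "\<one> = modulus l x \<otimes> q" unfolding divides_iff by blast
      then have "\<zero> \<prec> q" using zero_le zero_neq_one times_zero le_less by metis
      then have "modulus l x \<preceq> \<one>" using le_times times_comm q by metis
      then show False using one_less_modulus[OF l, of x] by simp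
    qed
    then show "\<exists>n. \<forall>x. x \<prec> b \<longrightarrow> (modulus l x dvds n \<longleftrightarrow> x \<in> A \<and> x \<prec> \<zero>)"
      using not_less_zero by blast
  next
    fix j assume "\<exists>n. \<forall>x. x \<prec> b \<longrightarrow> (modulus l x dvds n \<longleftrightarrow> x \<in> A \<and> x \<prec> j)"
    then obtain n where n: "\<And>x. x \<prec> b \<Longrightarrow> modulus l x dvds n \<longleftrightarrow> x \<in> A \<and> x \<prec> j" by blast
    show "\<exists>n. \<forall>x. x \<prec> b \<longrightarrow> (modulus l x dvds n \<longleftrightarrow> x \<in> A \<and> x \<prec> j \<oplus> \<one>)"
    proof (cases "j \<in> A \<and> j \<prec> b")
      case False
      then show ?thesis using n by (intro exI[of _ n]) (auto simp: less_succ)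
    next
      case True
      have "modulus l x dvds modulus l j \<otimes> n \<longleftrightarrow> modulus l x dvds n \<or> x = j" if "x \<prec> b" for x
        using that True modulus_coprime[OF l that, of j n] dvd_mult dvd_triv_left by blast
      then show ?thesis using n True by (intro exI[of _ "modulus l j \<otimes> n"]) (auto simp: less_succ)
    qed
  qed (use A in auto)
  from this[of b] show ?thesis unfolding coded_def by auto
qed

lemma no_injection:
  assumes C: "C \<in> Sets M"
    and total: "\<And>x. j \<preceq> x \<Longrightarrow> \<exists>c. c \<prec> k \<and> pr x c \<in> C"
    and inj: "\<And>x y c. pr x c \<in> C \<Longrightarrow> pr y c \<in> C \<Longrightarrow> j \<preceq> x \<Longrightarrow> j \<preceq> y \<Longrightarrow> x = y"
  shows False
proof -
  obtain l where l: "good l k" using ex_good by blast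
  obtain t where t: "\<zero> \<prec> t" "\<And>c. c \<prec> k \<Longrightarrow> modulus l c dvds t"
    using ex_common_multiple[of k \<one> l] by (auto simp: modulus_def)
  define mult where "mult b d \<longleftrightarrow> (\<forall>x. x \<prec> b \<longrightarrow> (\<forall>c. c \<prec> k \<longrightarrow> pr (x \<oplus> j) c \<in> C \<longrightarrow> modulus l c dvds d))" for b d
  \<comment> \<open>\<open>R a\<close> says that for some \<open>b\<close> every positive common
    multiple up to \<open>t\<close> for the first \<open>b\<close> points, counted from
    \<open>j\<close>, is at least \<open>a\<close>. Cutting off at \<open>t\<close> bounds the
    quantifier over \<open>d\<close>, so \<open>R\<close> is
    \<open>\<Sigma>\<^sup>0\<^sub>1\<close>.\<close>
  define R where "R a \<longleftrightarrow> (\<exists>b. \<forall>d. d \<prec> t \<oplus> \<one> \<longrightarrow> \<zero> \<prec> d \<and> mult b d \<longrightarrow> \<not> d \<prec> a)" for a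
  \<comment> \<open>\<open>R\<close> holds at zero and fails at \<open>t + 1\<close>, because
    \<open>t\<close> is a multiple for any number of points. Induction therefore has to break at
    some \<open>a\<close>.\<close>
  have "\<exists>a. R a \<and> \<not> R (a \<oplus> \<one>)"
  proof (rule ccontr)
    assume *: "\<nexists>a. R a \<and> \<not> R (a \<oplus> \<one>)"
    have "R (t \<oplus> \<one>)"
    proof (rule sigma_induct[where n = 0 and x = 1 and a = "t \<oplus> \<one>" and S = "\<lambda>_. C"
          and e = "(\<lambda>_. l)(2 := t, 3 := k, 4 := j)"])
      show "bounded (All 5 (Var 5 \<^bold>< Var 2 \<^bold>+ One \<^bold>\<longrightarrow> Zero \<^bold>< Var 5 \<^bold>\<and>
          All 6 (Var 6 \<^bold>< Var 1 \<^bold>\<longrightarrow> All 7 (Var 7 \<^bold>< Var 3 \<^bold>\<longrightarrow> pair (Var 6 \<^bold>+ Var 4) (Var 7) \<^bold>\<in> 0 \<^bold>\<longrightarrow>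
            dvd_fm 8 (modulus_tm (Var 9) (Var 7)) (Var 5))) \<^bold>\<longrightarrow> \<^bold>\<not> (Var 5 \<^bold>< Var 0)))"
        by (intro bounded.intros bounded_dvd_fm) auto
      show "range (\<lambda>_. C) \<subseteq> Sets M" using C by auto
      show "R \<zero>" by (simp add: R_def not_less_zero)
      show "\<And>a. R a \<Longrightarrow> R (a \<oplus> \<one>)" using * by blast
    qed (simp add: R_def mult_def)
    moreover have "mult b t" for b using t(2) by (auto simp: mult_def)
    ultimately show False unfolding R_def using t(1) less_succ by blast
  qed
  then obtain a where "R a" "\<not> R (a \<oplus> \<one>)" by blast
  then obtain b where b: "\<And>d. d \<prec> t \<oplus> \<one> \<Longrightarrow> \<zero> \<prec> d \<Longrightarrow> mult b d \<Longrightarrow> \<not> d \<prec> a" by (auto simp: R_def)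
  obtain d where d: "d \<prec> t \<oplus> \<one>" "\<zero> \<prec> d" "mult (b \<oplus> \<one>) d" "d \<prec> a \<oplus> \<one>"
    using \<open>\<not> R (a \<oplus> \<one>)\<close> unfolding R_def by blast
  \<comment> \<open>One more point does not raise the least multiple: \<open>d\<close> serves
    \<open>b + 1\<close> points, yet it cannot exceed \<open>a\<close>, and serving \<open>b\<close>
    points it cannot be smaller either.\<close>
  have "mult b d" using d(3) by (auto simp: mult_def less_succ)
  then have "d = a" using b[OF d(1,2)] d(4) by (auto simp: less_succ)
  have "j \<preceq> x \<oplus> j" for x using le_iff plus_comm by metis
  note total' = total[OF this] and inj' = inj[OF _ _ this this]
  obtain c where c: "c \<prec> k" "pr (b \<oplus> j) c \<in> C" using total' by blast
  then have "modulus l c dvds d" using d(3) by (auto simp: mult_def less_succ)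
  then obtain q where q: "d = modulus l c \<otimes> q" by (auto simp: divides_iff)
  have "\<zero> \<prec> q" using d(2) unfolding q using zero_le le_less by fastforce
  have "q \<prec> d"
    unfolding q using mult_strict_right_mono[OF one_less_modulus[OF l, of c] \<open>\<zero> \<prec> q\<close>] by simp
  \<comment> \<open>Dividing out the modulus of the new point's color keeps the moduli of the
    earlier colors, which are coprime to it by injectivity. So \<open>q\<close> is a smaller
    multiple for \<open>b\<close> points, against the choice of \<open>b\<close>.\<close>
  have "mult b q" unfolding mult_def
  proof (intro allI impI)
    fix x c' assume x: "x \<prec> b" "c' \<prec> k" "pr (x \<oplus> j) c' \<in> C"
    then have "c' \<noteq> c" using inj'[of x c b] c(2) by auto
    moreover have "modulus l c' dvds modulus l c \<otimes> q"
      using x \<open>mult b d\<close> q by (auto simp: mult_def)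
    ultimately show "modulus l c' dvds q" using modulus_coprime[OF l x(2) c(1)] by blast
  qed
  then show False using b[of q] \<open>\<zero> \<prec> q\<close> \<open>q \<prec> d\<close> \<open>d = a\<close> d(1) less_transitive by blast
qed

end

section \<open>From colorability to arithmetical comprehension\<close>

text \<open>Packs the first \<open>m\<close> variables into one number, so that the truth set of a
  formula in these variables is a set of numbers.\<close>

fun tuple_tm :: "nat \<Rightarrow> tm" where
  "tuple_tm 0 = Zero"
| "tuple_tm (Suc m) = pair (tuple_tm m) (Var m)"

text \<open>Variable \<open>m\<close> is meant to hold a tuple code, which bounds all components of
  the tuple.\<close>

fun bounded_ex :: "nat \<Rightarrow> nat \<Rightarrow> fm \<Rightarrow> fm" where
  "bounded_ex m 0 \<theta> = \<theta>"
| "bounded_ex m (Suc j) \<theta> = Ex j (Var j \<^bold>< Var m \<^bold>+ One \<^bold>\<and> bounded_ex m j \<theta>)"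

lemma bounded_bounded_ex: "bounded \<theta> \<Longrightarrow> j \<le> m \<Longrightarrow> bounded (bounded_ex m j \<theta>)"
  by (induction j) (auto intro!: bounded.intros)

lemma tm_vars_tuple_tm: "tm_vars (tuple_tm m) = {..<m}"
  by (induction m) (auto simp: lessThan_Suc)

lemma tm_vars_tm_subst: "tm_vars (tm_subst x r t) \<subseteq> tm_vars t \<union> tm_vars r"
  by (induction t) auto


section \<open>Graphs and colorings read in a model, and the reversal\<close>

context rca
begin

definition coloring where
  "coloring V E i k C \<longleftrightarrow>
    (\<forall>p\<in>C. \<exists>x y. p = pr x y \<and> pr i x \<in> V \<and> y \<prec> k) \<and>
    (\<forall>x. pr i x \<in> V \<longrightarrow> (\<exists>y. pr x y \<in> C)) \<and>
    (\<forall>x y z. pr x y \<in> C \<and> pr x z \<in> C \<longrightarrow> y = z) \<and>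
    (\<forall>x y. pr i (pr x y) \<in> E \<longrightarrow> (\<forall>u v. pr x u \<in> C \<and> pr y v \<in> C \<longrightarrow> u \<noteq> v))"

definition has_coloring where
  "has_coloring V E i \<longleftrightarrow> (\<exists>k. \<exists>C\<in>Sets M. coloring V E i k C)"

definition graph where
  "graph V E i \<longleftrightarrow> (\<forall>p. pr i p \<in> E \<longrightarrow>
    (\<exists>x y. p = pr x y \<and> pr i x \<in> V \<and> pr i y \<in> V \<and> x \<noteq> y \<and> pr i (pr y x) \<in> E))"

definition decides_colorability where
  "decides_colorability V E F \<longleftrightarrow>
    (\<forall>p\<in>F. \<exists>x y. p = pr x y \<and> (y = \<zero> \<or> y = \<one>)) \<and>
    (\<forall>x. \<exists>y. pr x y \<in> F) \<and>
    (\<forall>x y z. pr x y \<in> F \<and> pr x z \<in> F \<longrightarrow> y = z) \<and>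
    (\<forall>i. (has_coloring V E i \<longrightarrow> pr i \<one> \<in> F) \<and> (\<not> has_coloring V E i \<longrightarrow> pr i \<zero> \<in> F))"

lemma sat_colorable: "sat M e S (colorable 0 1 0) \<longleftrightarrow> has_coloring (S 0) (S 1) (e 0)"
  unfolding has_coloring_def coloring_def colorable_def is_coloring_def is_function_def mem_seq_def Let_def
  by (simp add: Ball_def)

lemma models_colorability_iff:
  "M \<Turnstile> {colorability_function_exists} \<longleftrightarrow>
    (\<forall>V\<in>Sets M. \<forall>E\<in>Sets M. (\<forall>i. graph V E i) \<longrightarrow> (\<exists>F\<in>Sets M. decides_colorability V E F))"
proof -
  obtain S :: "nat \<Rightarrow> 'a set" where S: "range S \<subseteq> Sets M" by (rule range_const)
  have "sat M e S colorability_function_exists \<longleftrightarrow>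
    (\<forall>V\<in>Sets M. \<forall>E\<in>Sets M. (\<forall>i. graph V E i) \<longrightarrow> (\<exists>F\<in>Sets M. decides_colorability V E F))" for e S
    unfolding colorability_function_exists_def Let_def
    by (simp add: sat_colorable[simplified] is_function_def is_graph_def mem_seq_def
      graph_def decides_colorability_def Ball_def Let_def)
  then show ?thesis using S by (auto simp: models_def)
qed

text \<open>Requiring the witness \<open>j\<close> to lie below the vertex makes the edge relation
  bounded, and a nonempty row of \<open>D\<close> still yields a clique on a final segment of the
  numbers.\<close>

lemma clique_edges_in_Sets:
  assumes "D \<in> Sets M"
  shows "\<exists>E\<in>Sets M. \<forall>p. p \<in> E \<longleftrightarrow> (\<exists>i x y. p = pr i (pr x y) \<and> x \<noteq> y \<and>
    (\<exists>j. j \<prec> x \<and> pr i j \<in> D) \<and> (\<exists>j. j \<prec> y \<and> pr i j \<in> D))"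
proof (intro bexI allI)
  let ?P = "\<lambda>p. \<exists>i x y. p = pr i (pr x y) \<and> x \<noteq> y \<and>
    (\<exists>j. j \<prec> x \<and> pr i j \<in> D) \<and> (\<exists>j. j \<prec> y \<and> pr i j \<in> D)"
  have bnd: "i \<prec> pr i (pr x y) \<oplus> \<one>" "x \<prec> pr i (pr x y) \<oplus> \<one>" "y \<prec> pr i (pr x y) \<oplus> \<one>" for i x y
    using le_pr order_trans by (auto simp: less_succ_iff_le, blast+)
  show "Collect ?P \<in> Sets M"
  proof (rule delta_comprehension[where n = 0 and S = "\<lambda>_. D"])
    show "bounded (Ex 1 (Var 1 \<^bold>< Var 0 \<^bold>+ One \<^bold>\<and> Ex 2 (Var 2 \<^bold>< Var 0 \<^bold>+ One \<^bold>\<and> Ex 3 (Var 3 \<^bold>< Var 0 \<^bold>+ One \<^bold>\<and>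
       Var 0 \<^bold>= pair (Var 1) (pair (Var 2) (Var 3)) \<^bold>\<and> \<^bold>\<not> (Var 2 \<^bold>= Var 3) \<^bold>\<and>
       Ex 4 (Var 4 \<^bold>< Var 2 \<^bold>\<and> pair (Var 1) (Var 4) \<^bold>\<in> 0) \<^bold>\<and>
       Ex 4 (Var 4 \<^bold>< Var 3 \<^bold>\<and> pair (Var 1) (Var 4) \<^bold>\<in> 0)))))"
      by (intro bounded.intros) auto
  qed (use assms bnd in auto)
qed auto

lemma projection_of_colorability:
  assumes colorability: "M \<Turnstile> {colorability_function_exists}" and D: "D \<in> Sets M"
  shows "{i. \<exists>j. pr i j \<in> D} \<in> Sets M"
proof -
  obtain E where E: "E \<in> Sets M" "\<And>p. p \<in> E \<longleftrightarrow> (\<exists>i x y. p = pr i (pr x y) \<and> x \<noteq> y \<and>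
    (\<exists>j. j \<prec> x \<and> pr i j \<in> D) \<and> (\<exists>j. j \<prec> y \<and> pr i j \<in> D))"
    using clique_edges_in_Sets[OF D] by auto
  obtain S :: "nat \<Rightarrow> 'a set" where S: "range S \<subseteq> Sets M" by (rule range_const)
  have V: "UNIV \<in> Sets M"
    using delta_comprehension[where \<theta> = "Zero \<^bold>= Zero" and P = "\<lambda>_. True", OF _ S]
    by (auto intro: bounded.intros)
  have "graph UNIV E i" for i unfolding graph_def E(2) by auto
  then obtain F where F: "F \<in> Sets M" "decides_colorability UNIV E F"
    using colorability V E(1) unfolding models_colorability_iff by blast
  have "has_coloring UNIV E i \<longleftrightarrow> (\<nexists>j. pr i j \<in> D)" for i
  proof
    assume "has_coloring UNIV E i"
    then obtain k C where C: "C \<in> Sets M" "coloring UNIV E i k C" by (auto simp: has_coloring_def)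
    show "\<nexists>j. pr i j \<in> D"
    proof
      assume "\<exists>j. pr i j \<in> D"
      then obtain j where j: "pr i j \<in> D" by blast
      show False
      \<comment> \<open>All numbers above a witness \<open>j\<close> are pairwise adjacent, so a
        coloring is injective from \<open>j + 1\<close> on.\<close>
      proof (rule no_injection[OF C(1), of "j \<oplus> \<one>" k])
        fix x show "\<exists>c. c \<prec> k \<and> pr x c \<in> C" using C(2) unfolding coloring_def
          by (metis UNIV_I pr_eq_iff)
      next
        fix x y c assume "pr x c \<in> C" "pr y c \<in> C" "j \<oplus> \<one> \<preceq> x" "j \<oplus> \<one> \<preceq> y"
        moreover from this have "pr i (pr x y) \<in> E" if "x \<noteq> y"
          using that j by (auto simp: E(2) less_iff_succ_le)
        ultimately show "x = y" using C(2) unfolding coloring_def by blast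
      qed
    qed
  next
    assume none: "\<nexists>j. pr i j \<in> D"
    \<comment> \<open>Without edges the constant color zero works; the bound on \<open>x\<close>
      keeps its definition bounded.\<close>
    let ?C = "{p. \<exists>x. x \<prec> p \<oplus> \<one> \<and> p = pr x \<zero>}"
    have "?C \<in> Sets M"
      by (rule delta_comprehension[where n = 0 and \<theta> = "Ex 1 (Var 1 \<^bold>< Var 0 \<^bold>+ One \<^bold>\<and> Var 0 \<^bold>= pair (Var 1) Zero)", OF _ S])
       (auto intro!: bounded.intros)
    moreover have "coloring UNIV E i \<one> ?C"
      using none le_pr zero_below_one unfolding coloring_def
      by (auto simp: E(2) less_succ_iff_le)
    ultimately show "has_coloring UNIV E i" by (auto simp: has_coloring_def)
  qed
  \<comment> \<open>Uncolorable graphs are those with value zero, so the projection is recursive in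
    \<open>F\<close>.\<close>
  then have "pr i \<zero> \<in> F \<longleftrightarrow> (\<exists>j. pr i j \<in> D)" for i
    using F(2) zero_neq_one unfolding decides_colorability_def by metis
  then have "{i. \<exists>j. pr i j \<in> D} = {i. pr i \<zero> \<in> F}" by auto
  also have "\<dots> \<in> Sets M"
    by (rule delta_comprehension[where n = 0 and \<theta> = "pair (Var 0) Zero \<^bold>\<in> 0" and S = "\<lambda>_. F"])
      (use F in \<open>auto intro: bounded.intros\<close>)
  finally show ?thesis .
qed

section \<open>Truth sets of arithmetical formulas\<close>

abbreviation tuple where "tuple e m \<equiv> val M e (tuple_tm m)"

lemma tuple_eq_iff: "tuple e m = tuple e' m \<longleftrightarrow> (\<forall>i<m. e i = e' i)"
  by (induction m) (auto simp: less_Suc_eq)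

lemma le_tuple: "i < m \<Longrightarrow> e i \<preceq> tuple e m"
proof (induction m)
  case (Suc m)
  then show ?case using le_pr order_trans by (auto simp: less_Suc_eq)
qed simp

lemma sat_bounded_ex:
  "j \<le> m \<Longrightarrow> sat M e S (bounded_ex m j \<theta>) \<longleftrightarrow>
    (\<exists>e'. (\<forall>i\<ge>j. e' i = e i) \<and> (\<forall>i<j. e' i \<prec> e m \<oplus> \<one>) \<and> sat M e' S \<theta>)"
proof (induction j arbitrary: e)
  case 0
  have "(\<forall>i\<ge>0. e' i = e i) \<longleftrightarrow> e' = e" for e' :: "nat \<Rightarrow> 'a" by auto
  then show ?case by simp
next
  case (Suc j)
  then have "j \<noteq> m" by simp
  then have "sat M e S (bounded_ex m (Suc j) \<theta>) \<longleftrightarrow> (\<exists>a. a \<prec> e m \<oplus> \<one> \<and> (\<exists>e'.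
      (\<forall>i\<ge>j. e' i = (e(j := a)) i) \<and> (\<forall>i<j. e' i \<prec> e m \<oplus> \<one>) \<and> sat M e' S \<theta>))"
    using Suc by simp
  also have "\<dots> \<longleftrightarrow> (\<exists>e'. (\<forall>i\<ge>Suc j. e' i = e i) \<and> (\<forall>i<Suc j. e' i \<prec> e m \<oplus> \<one>) \<and> sat M e' S \<theta>)"
    (is "?L \<longleftrightarrow> ?R")
  proof
    assume ?L
    then obtain a e' where e': "a \<prec> e m \<oplus> \<one>" "\<And>i. i \<ge> j \<Longrightarrow> e' i = (e(j := a)) i"
      "\<forall>i<j. e' i \<prec> e m \<oplus> \<one>" "sat M e' S \<theta>" by blast
    then show ?R by (intro exI[of _ e']) (auto simp: less_Suc_eq)
  next
    assume ?R
    then obtain e' where e': "\<And>i. i \<ge> Suc j \<Longrightarrow> e' i = e i" "\<And>i. i < Suc j \<Longrightarrow> e' i \<prec> e m \<oplus> \<one>"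
      "sat M e' S \<theta>" by blast
    then show ?L by (intro exI[of _ "e' j"] conjI exI[of _ e']) (auto simp: Suc_le_eq)
  qed
  finally show ?case .
qed

text \<open>Only the first \<open>m\<close> variables matter, and each is at most the tuple code, so
  decoding takes bounded quantifiers only and recursive comprehension applies.\<close>

lemma bounded_tuples:
  assumes "bounded \<theta>" "fm_vars \<theta> \<subseteq> {..<m}" "range S \<subseteq> Sets M"
  shows "\<exists>Y\<in>Sets M. \<forall>e. tuple e m \<in> Y \<longleftrightarrow> sat M e S \<theta>"
proof -
  let ?\<theta> = "bounded_ex m m (Var m \<^bold>= tuple_tm m \<^bold>\<and> \<theta>)"
  define Y where "Y = {p. sat M ((\<lambda>_. \<zero>)(m := p)) S ?\<theta>}"
  have "Y \<in> Sets M" unfolding Y_def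
    by (rule delta_comprehension[OF _ assms(3)])
      (auto intro!: bounded_bounded_ex bounded.intros assms(1))
  moreover have "tuple e m \<in> Y \<longleftrightarrow> sat M e S \<theta>" for e
  proof
    assume "tuple e m \<in> Y"
    then obtain e' where e': "e' m = tuple e m" "e' m = tuple e' m" "sat M e' S \<theta>"
      by (auto simp: Y_def sat_bounded_ex)
    then have "sat M e' S \<theta> = sat M e S \<theta>"
      by (intro sat_cong) (use tuple_eq_iff assms(2) in auto)
    then show "sat M e S \<theta>" using e' by simp
  next
    assume *: "sat M e S \<theta>"
    let ?e = "\<lambda>i. if i < m then e i else if i = m then tuple e m else \<zero>"
    have "tuple ?e m = tuple e m" by (simp add: tuple_eq_iff)
    moreover have "sat M ?e S \<theta> = sat M e S \<theta>" by (rule sat_cong) (use assms(2) in auto)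
    ultimately show "tuple e m \<in> Y" unfolding Y_def mem_Collect_eq sat_bounded_ex[OF Nat.le_refl]
      using * le_tuple by (intro exI[of _ ?e]) (auto simp: less_succ_iff_le)
  qed
  ultimately show ?thesis by blast
qed

text \<open>Induction on the formula: complement and union are recursive and an existential
  quantifier is a projection. Conjunction, implication and the universal quantifier are reduced to
  these by negation.\<close>

lemma arithmetical_tuples:
  assumes proj: "\<And>D. D \<in> Sets M \<Longrightarrow> {a. \<exists>b. pr a b \<in> D} \<in> Sets M"
    and S: "range S \<subseteq> Sets M"
  shows "arithmetical \<phi> \<Longrightarrow> fm_vars \<phi> \<subseteq> {..<m} \<Longrightarrow>
    \<exists>Y\<in>Sets M. \<forall>e. tuple e m \<in> Y \<longleftrightarrow> sat M e S \<phi>"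
proof (induction \<phi>)
  have complement: "\<exists>Y'\<in>Sets M. \<forall>e. tuple e m \<in> Y' \<longleftrightarrow> tuple e m \<notin> Y" if "Y \<in> Sets M" for Y
    using bounded_tuples[of "\<^bold>\<not> (tuple_tm m \<^bold>\<in> 0)" m "\<lambda>_. Y"] that
    by (auto intro: bounded.intros simp: tm_vars_tuple_tm)
  have union: "\<exists>Z'\<in>Sets M. \<forall>e. tuple e m \<in> Z' \<longleftrightarrow> tuple e m \<in> Y \<or> tuple e m \<in> Z"
    if "Y \<in> Sets M" "Z \<in> Sets M" for Y Z
    using bounded_tuples[of "tuple_tm m \<^bold>\<in> 0 \<^bold>\<or> tuple_tm m \<^bold>\<in> 1" m "(\<lambda>_. Y)(1 := Z)"] that
    by (auto intro: bounded.intros simp: tm_vars_tuple_tm image_subset_iff)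
  have ex: "\<exists>Z\<in>Sets M. \<forall>e. tuple e m \<in> Z \<longleftrightarrow> (\<exists>a. tuple (e(x := a)) m \<in> Y)"
    if "Y \<in> Sets M" "x < m" for Y x
  proof -
    \<comment> \<open>An additional component \<open>m\<close> carries the candidate value of
      \<open>x\<close>. It is the second entry of the outermost pair, so projecting \<open>D\<close>
      quantifies over it.\<close>
    have "fm_vars (tm_subst x (Var m) (tuple_tm m) \<^bold>\<in> 0) \<subseteq> {..<Suc m}"
      using tm_vars_tm_subst[of x "Var m" "tuple_tm m"] by (auto simp: tm_vars_tuple_tm)
    from bounded_tuples[OF bounded.intros(3) this, of "\<lambda>_. Y"] \<open>Y \<in> Sets M\<close>
    obtain D where D: "D \<in> Sets M" "\<And>e. tuple e (Suc m) \<in> D \<longleftrightarrow> tuple (e(x := e m)) m \<in> Y"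
      by (auto simp: val_tm_subst simp del: tuple_tm.simps)
    have "pr (tuple e m) a \<in> D \<longleftrightarrow> tuple (e(x := a)) m \<in> Y" for e a
    proof -
      have "tuple (e(m := a)) m = tuple e m" "tuple (e(m := a, x := a)) m = tuple (e(x := a)) m"
        using \<open>x < m\<close> by (auto simp: tuple_eq_iff)
      then show ?thesis using D(2)[of "e(m := a)"] by simp
    qed
    then show ?thesis
      using proj[OF D(1)] by (intro bexI[of _ "{a. \<exists>b. pr a b \<in> D}"]) (simp_all only: mem_Collect_eq simp_thms)
  qed
  {
    case (Neg \<phi>)
    then obtain Y where Y: "Y \<in> Sets M" "\<And>e. tuple e m \<in> Y \<longleftrightarrow> sat M e S \<phi>" by auto
    show ?case using complement[OF Y(1)] unfolding Y(2) sat.simps .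
  next
    case (And \<phi> \<psi>)
    then obtain Y Z where YZ: "Y \<in> Sets M" "Z \<in> Sets M" "\<And>e. tuple e m \<in> Y \<longleftrightarrow> \<not> sat M e S \<phi>"
      "\<And>e. tuple e m \<in> Z \<longleftrightarrow> \<not> sat M e S \<psi>" using complement by (simp, metis)
    then show ?case using union[OF YZ(1,2)] complement by (simp, metis)
  next
    case (Or \<phi> \<psi>)
    then show ?case using union by (simp, metis)
  next
    case (Imp \<phi> \<psi>)
    then obtain Y Z where YZ: "Y \<in> Sets M" "Z \<in> Sets M" "\<And>e. tuple e m \<in> Y \<longleftrightarrow> \<not> sat M e S \<phi>"
      "\<And>e. tuple e m \<in> Z \<longleftrightarrow> sat M e S \<psi>" using complement by (simp, metis)
    then show ?case using union[OF YZ(1,2)] by simp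
  next
    case (All x \<phi>)
    then obtain Y where Y: "Y \<in> Sets M" "x < m" "\<And>e. tuple e m \<in> Y \<longleftrightarrow> \<not> sat M e S \<phi>"
      using complement by (simp, metis)
    then show ?case using ex[OF Y(1,2)] complement by (simp, metis)
  next
    case (Ex x \<phi>)
    then show ?case using ex by (simp, metis)
  }
qed (simp_all only: arithmetical.simps bounded_tuples[OF bounded.intros(1) _ S]
  bounded_tuples[OF bounded.intros(2) _ S] bounded_tuples[OF bounded.intros(3) _ S])

text \<open>The set demanded by comprehension is the section of the truth set in which all variables
  but \<open>n\<close> keep their values under \<open>e\<close>.\<close>

lemma ACA0_of_projection:
  assumes proj: "\<And>D. D \<in> Sets M \<Longrightarrow> {a. \<exists>b. pr a b \<in> D} \<in> Sets M"
  shows "M \<Turnstile> ACA0"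
proof -
  have "sat M e S (comprehension_axiom X n \<phi>)"
    if \<phi>: "arithmetical \<phi>" "X \<notin> free_sets \<phi>" and S: "range S \<subseteq> Sets M" for X n \<phi> e S
  proof -
    obtain m where m: "fm_vars \<phi> \<subseteq> {..<m}"
      using finite_fm_vars[of \<phi>] by (auto simp: finite_nat_set_iff_bounded)
    then obtain Y where Y: "Y \<in> Sets M" "\<And>e. tuple e m \<in> Y \<longleftrightarrow> sat M e S \<phi>"
      using arithmetical_tuples[OF proj S \<phi>(1)] by blast
    have "{a. tuple (e(n := a)) m \<in> Y} \<in> Sets M"
      by (rule delta_comprehension[where \<theta> = "tuple_tm m \<^bold>\<in> 0" and S = "\<lambda>_. Y"])
        (use Y in \<open>auto intro: bounded.intros\<close>)
    moreover have "sat M e' (S(X := A)) \<phi> = sat M e' S \<phi>" for e' A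
      by (rule sat_cong) (use \<phi>(2) in auto)
    ultimately show ?thesis
      unfolding comprehension_axiom_def Y(2) sat.simps
      by (intro bexI[of _ "{a. sat M (e(n := a)) S \<phi>}"]) simp_all
  qed
  then show ?thesis using rca by (auto simp: models_def ACA0_def)
qed

end

section \<open>Compactness from arithmetical comprehension\<close>

text \<open>The bound variable 50 is larger than every variable of the formulas below.\<close>

definition mem_coded_fm :: "tm \<Rightarrow> tm \<Rightarrow> tm \<Rightarrow> fm" where
  "mem_coded_fm z l n = dvd_fm 50 (modulus_tm l z) n"

lemma arithmetical_mem_coded_fm [simp]: "arithmetical (mem_coded_fm z l n)"
  by (simp add: mem_coded_fm_def)

text \<open>Variables 1 and 2 code the set, 3 is the bound on the points, 4 is the index of the graph and
  5 the number of colors. All points below the bound get a color, vertices or not, and possibly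
  several; both are repaired when a total coloring is extracted.\<close>

definition partial_coloring_fm :: fm where
  "partial_coloring_fm =
    All 10 (Var 10 \<^bold>< Var 3 \<^bold>\<longrightarrow> Ex 11 (Var 11 \<^bold>< Var 5 \<^bold>\<and>
      mem_coded_fm (pair (Var 10) (Var 11)) (Var 1) (Var 2)))
    \<^bold>\<and> All 10 (Var 10 \<^bold>< Var 3 \<^bold>\<longrightarrow> All 11 (Var 11 \<^bold>< Var 3 \<^bold>\<longrightarrow> All 12 (Var 12 \<^bold>< Var 5 \<^bold>\<longrightarrow>
      pair (Var 4) (pair (Var 10) (Var 11)) \<^bold>\<in> 0 \<^bold>\<longrightarrow>
      \<^bold>\<not> (mem_coded_fm (pair (Var 10) (Var 12)) (Var 1) (Var 2)
        \<^bold>\<and> mem_coded_fm (pair (Var 11) (Var 12)) (Var 1) (Var 2)))))"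

lemma arithmetical_partial_coloring_fm [simp]: "arithmetical partial_coloring_fm"
  by (simp add: partial_coloring_fm_def)

section \<open>Finite partial colorings\<close>

context rca
begin

lemma sat_mem_coded_fm [simp]:
  "50 \<notin> tm_vars z \<union> tm_vars l \<union> tm_vars n \<Longrightarrow>
    sat M e S (mem_coded_fm z l n) \<longleftrightarrow> val M e z \<in> coded (val M e l) (val M e n)"
  by (simp add: mem_coded_fm_def mem_coded)

definition partial_coloring where
  "partial_coloring E i k b D \<longleftrightarrow>
    (\<forall>x. x \<prec> b \<longrightarrow> (\<exists>c. c \<prec> k \<and> pr x c \<in> D)) \<and>
    (\<forall>x. x \<prec> b \<longrightarrow> (\<forall>y. y \<prec> b \<longrightarrow> (\<forall>c. c \<prec> k \<longrightarrow> pr i (pr x y) \<in> E \<longrightarrow>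
      \<not> (pr x c \<in> D \<and> pr y c \<in> D))))"

lemma sat_partial_coloring_fm [simp]:
  "sat M e S partial_coloring_fm \<longleftrightarrow>
    partial_coloring (S 0) (e 4) (e 5) (e 3) (coded (e 1) (e 2))"
  by (simp add: partial_coloring_fm_def partial_coloring_def)

text \<open>Otherwise bounded induction would show that \<open>A\<close> has no element below any
  given number. This is used to select the least color of a vertex.\<close>

lemma least_element:
  assumes A: "A \<in> Sets M" "a \<in> A"
  shows "\<exists>m\<in>A. \<forall>z. z \<prec> m \<longrightarrow> z \<notin> A"
proof (rule ccontr)
  assume *: "\<not> ?thesis"
  have "\<forall>z. z \<prec> a \<oplus> \<one> \<longrightarrow> z \<notin> A"
    by (rule bounded_induct[where n = 0 and S = "\<lambda>_. A" and a = "a \<oplus> \<one>"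
        and \<theta> = "All 1 (Var 1 \<^bold>< Var 0 \<^bold>\<longrightarrow> \<^bold>\<not> (Var 1 \<^bold>\<in> 0))"])
      (use * A in \<open>auto intro!: bounded.intros simp: not_less_zero less_succ\<close>)
  then show False using A(2) less_succ by blast
qed

lemma partial_coloring_antimono:
  "b \<preceq> b' \<Longrightarrow> partial_coloring E i k b' D \<Longrightarrow> partial_coloring E i k b D"
  unfolding partial_coloring_def using less_le_trans by blast

text \<open>Only pairs of a point below \<open>b\<close> and a color below \<open>k\<close> are
  inspected, and their codes lie below \<open>pr b k\<close>.\<close>

lemma partial_coloring_local:
  assumes "\<And>z. z \<prec> pr b k \<Longrightarrow> z \<in> D \<longleftrightarrow> z \<in> D'" and "partial_coloring E i k b D"
  shows "partial_coloring E i k b D'"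
proof -
  have "pr x c \<in> D \<longleftrightarrow> pr x c \<in> D'" if "x \<prec> b" "c \<prec> k" for x c
    using assms(1) pr_less add_strict_mono that by blast
  then show ?thesis using assms(2) unfolding partial_coloring_def by blast
qed

text \<open>Numbers that are not vertices receive the extra color \<open>k\<close>. Edges join
  vertices only, so the extra color never conflicts.\<close>

lemma partial_coloring_of_coloring:
  assumes V: "V \<in> Sets M" and graph: "graph V E i" and C: "C \<in> Sets M" "coloring V E i k C"
  shows "\<exists>l n. partial_coloring E i (k \<oplus> \<one>) b (coded l n)"
proof -
  define D where "D = {p. p \<in> C \<or> (\<exists>x. x \<prec> p \<oplus> \<one> \<and> p = pr x k \<and> pr i x \<notin> V)}"
  have D: "D \<in> Sets M" unfolding D_def
    by (rule delta_comprehension[where n = 0 and S = "(\<lambda>_. V)(1 := C)" and e = "(\<lambda>_. i)(2 := k)"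
        and \<theta> = "Var 0 \<^bold>\<in> 1 \<^bold>\<or> Ex 3 (Var 3 \<^bold>< Var 0 \<^bold>+ One \<^bold>\<and> Var 0 \<^bold>= pair (Var 3) (Var 2)
          \<^bold>\<and> \<^bold>\<not> (pair (Var 1) (Var 3) \<^bold>\<in> 0))"])
      (use V C in \<open>auto intro!: bounded.intros\<close>)
  have memD: "pr x c \<in> D \<longleftrightarrow> pr x c \<in> C \<or> c = k \<and> pr i x \<notin> V" for x c
    unfolding D_def using le_pr by (auto simp: less_succ_iff_le)
  have "partial_coloring E i (k \<oplus> \<one>) b D"
    unfolding partial_coloring_def
  proof (intro conjI allI impI)
    fix x
    show "\<exists>c. c \<prec> k \<oplus> \<one> \<and> pr x c \<in> D"
    proof (cases "pr i x \<in> V")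
      case True
      then obtain y where "pr x y \<in> C" "y \<prec> k" using C(2) unfolding coloring_def by (metis pr_eq_iff)
      then show ?thesis unfolding memD less_succ by blast
    next
      case False
      then have "pr x k \<in> D" by (simp add: memD)
      moreover have "k \<prec> k \<oplus> \<one>" by (simp add: less_succ)
      ultimately show ?thesis by blast
    qed
  next
    fix x y c assume e: "pr i (pr x y) \<in> E"
    then have "pr i x \<in> V" "pr i y \<in> V" using graph unfolding graph_def by auto
    then show "\<not> (pr x c \<in> D \<and> pr y c \<in> D)"
      using C(2) e unfolding memD coloring_def by blast
  qed
  moreover obtain l n where "\<forall>x. x \<prec> pr b (k \<oplus> \<one>) \<longrightarrow> (x \<in> coded l n \<longleftrightarrow> x \<in> D)"
    using ex_coded[OF D] by blast
  ultimately show ?thesis using partial_coloring_local[of b "k \<oplus> \<one>" D "coded l n"] by blast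
qed

text \<open>Keeping only the least color of each vertex restores uniqueness and drops the numbers
  that are not vertices.\<close>

lemma coloring_of_partial_colorings:
  assumes V: "V \<in> Sets M" and graph: "graph V E i" and D: "D \<in> Sets M"
    and partial: "\<And>b. partial_coloring E i k b D"
  shows "has_coloring V E i"
proof -
  let ?P = "\<lambda>p. \<exists>x. x \<prec> p \<oplus> \<one> \<and> (\<exists>c. c \<prec> k \<and> p = pr x c \<and> pr i x \<in> V \<and> p \<in> D \<and>
    (\<forall>c'. c' \<prec> c \<longrightarrow> pr x c' \<notin> D))"
  have total: "\<exists>c. c \<prec> k \<and> pr x c \<in> D" for x
    using partial[of "x \<oplus> \<one>"] unfolding partial_coloring_def less_succ by blast
  have proper: "\<not> (pr x c \<in> D \<and> pr y c \<in> D)" if "pr i (pr x y) \<in> E" "c \<prec> k" for x y c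
    \<comment> \<open>This bound exceeds both endpoints.\<close>
    using partial[of "x \<oplus> y \<oplus> \<one>"] that less_succ_iff_le zero_le
    unfolding partial_coloring_def by (metis add_increasing add_increasing2 order_refl)
  have "Collect ?P \<in> Sets M"
  proof (rule delta_comprehension[where n = 0 and S = "(\<lambda>_. V)(1 := D)" and e = "(\<lambda>_. i)(2 := k)"])
    show "bounded (Ex 3 (Var 3 \<^bold>< Var 0 \<^bold>+ One \<^bold>\<and> Ex 4 (Var 4 \<^bold>< Var 2 \<^bold>\<and> Var 0 \<^bold>= pair (Var 3) (Var 4) \<^bold>\<and>
        pair (Var 1) (Var 3) \<^bold>\<in> 0 \<^bold>\<and> Var 0 \<^bold>\<in> 1 \<^bold>\<and>
        All 5 (Var 5 \<^bold>< Var 4 \<^bold>\<longrightarrow> \<^bold>\<not> (pair (Var 3) (Var 5) \<^bold>\<in> 1)))))"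
      by (intro bounded.intros) auto
  qed (use V D in auto)
  moreover have mem: "pr x c \<in> Collect ?P \<longleftrightarrow>
      c \<prec> k \<and> pr i x \<in> V \<and> pr x c \<in> D \<and> (\<forall>c'. c' \<prec> c \<longrightarrow> pr x c' \<notin> D)" for x c
    using le_pr by (auto simp: less_succ_iff_le)
  have "coloring V E i k (Collect ?P)"
    unfolding coloring_def
  proof (intro conjI allI impI ballI)
    fix x assume x: "pr i x \<in> V"
    obtain c where c: "c \<prec> k" "pr x c \<in> D" using total by blast
    have "{c. pr x c \<in> D} \<in> Sets M"
      by (rule delta_comprehension[where n = 0 and S = "\<lambda>_. D" and e = "\<lambda>_. x"
          and \<theta> = "pair (Var 1) (Var 0) \<^bold>\<in> 0"]) (use D in \<open>auto intro: bounded.intros\<close>)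
    from least_element[OF this, of c] c(2) obtain m
      where m: "pr x m \<in> D" "\<And>z. z \<prec> m \<Longrightarrow> pr x z \<notin> D" by auto
    have "m \<prec> k" using m(2)[of c] c less_total less_transitive by blast
    then show "\<exists>y. pr x y \<in> Collect ?P" using m x unfolding mem by blast
  next
    fix x y z assume "pr x y \<in> Collect ?P \<and> pr x z \<in> Collect ?P"
    then show "y = z" unfolding mem using less_total by blast
  next
    fix x y u v assume "pr i (pr x y) \<in> E" "pr x u \<in> Collect ?P \<and> pr y v \<in> Collect ?P"
    then show "u \<noteq> v" unfolding mem using proper by blast
  qed auto
  ultimately show ?thesis by (auto simp: has_coloring_def)
qed

end

section \<open>Arithmetical comprehension, leftmost paths and deciding colorability\<close>

locale aca = rca +
  assumes aca: "M \<Turnstile> ACA0"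
begin

lemma comprehension:
  assumes "arithmetical \<phi>" and S: "range S \<subseteq> Sets M"
    and P: "\<And>a. P a \<longleftrightarrow> sat M (e(n := a)) S \<phi>"
  shows "Collect P \<in> Sets M"
proof -
  obtain X where X: "X \<notin> free_sets \<phi>"
    using finite_free_sets ex_new_if_finite infinite_UNIV_nat by blast
  have [simp]: "sat M (e(n := a)) (S(X := A)) \<phi> = P a" for a A
    unfolding P by (rule sat_cong) (use X in auto)
  have "comprehension_axiom X n \<phi> \<in> ACA0" using assms(1) X by (auto simp: ACA0_def)
  then have "sat M e S (comprehension_axiom X n \<phi>)" using aca S by (auto simp: models_def)
  then obtain A where "A \<in> Sets M" "\<And>a. a \<in> A \<longleftrightarrow> P a" by (auto simp: comprehension_axiom_def)
  moreover from this have "Collect P = A" by auto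
  ultimately show ?thesis by simp
qed

text \<open>Comprehension turns \<open>P\<close> into a set, and membership in a set is a bounded
  formula.\<close>

lemma arithmetical_induct:
  assumes "arithmetical \<phi>" "range S \<subseteq> Sets M" "\<And>a. P a \<longleftrightarrow> sat M (e(n := a)) S \<phi>"
    and "P \<zero>" "\<And>a. P a \<Longrightarrow> P (a \<oplus> \<one>)"
  shows "P a"
  by (rule bounded_induct[where n = 0 and S = "\<lambda>_. Collect P" and \<theta> = "Var 0 \<^bold>\<in> 0"])
    (use comprehension[OF assms(1-3)] assms(4,5) in \<open>auto intro: bounded.intros\<close>)

text \<open>The witness is the leftmost path: a number is left out whenever this keeps all levels of
  \<open>T\<close> within reach.\<close>

lemma compactness:
  assumes T: "T \<in> Sets M"
    and nonempty: "\<And>b. \<exists>l n. pr (pr l n) b \<in> T"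
    and mono: "\<And>l n b b'. b \<preceq> b' \<Longrightarrow> pr (pr l n) b' \<in> T \<Longrightarrow> pr (pr l n) b \<in> T"
  shows "\<exists>C\<in>Sets M. \<forall>m b. \<exists>l n. pr (pr l n) b \<in> T \<and> (\<forall>z. z \<prec> m \<longrightarrow> (z \<in> coded l n \<longleftrightarrow> z \<in> C))"
proof -
  \<comment> \<open>At every level some member of \<open>T\<close> agrees with the code below
    \<open>y\<close> and leaves \<open>y\<close> out.\<close>
  define zero_ok where "zero_ok l n y \<longleftrightarrow> (\<forall>b. \<exists>l' n'. pr (pr l' n') b \<in> T \<and>
    (\<forall>z. z \<prec> y \<longrightarrow> (z \<in> coded l' n' \<longleftrightarrow> z \<in> coded l n)) \<and> y \<notin> coded l' n')" for l n y
  have zero_ok_cong: "zero_ok l n y \<longleftrightarrow> zero_ok l' n' y"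
    if "\<And>z. z \<prec> y \<Longrightarrow> z \<in> coded l n \<longleftrightarrow> z \<in> coded l' n'" for l n l' n' y
    unfolding zero_ok_def using that by auto
  \<comment> \<open>As a set, \<open>zero_ok\<close> enters the later formulas by a single
    membership.\<close>
  define H where "H = {p. \<exists>l n y. p = pr (pr l n) y \<and> zero_ok l n y}"
  have H: "H \<in> Sets M"
    unfolding H_def zero_ok_def
    by (rule comprehension[where n = 0 and S = "\<lambda>_. T" and \<phi> =
      "Ex 1 (Ex 2 (Ex 3 (Var 0 \<^bold>= pair (pair (Var 1) (Var 2)) (Var 3) \<^bold>\<and> All 4 (Ex 5 (Ex 6 (
        pair (pair (Var 5) (Var 6)) (Var 4) \<^bold>\<in> 0 \<^bold>\<and>
        All 7 (Var 7 \<^bold>< Var 3 \<^bold>\<longrightarrow> (mem_coded_fm (Var 7) (Var 5) (Var 6) \<^bold>\<longleftrightarrow>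
          mem_coded_fm (Var 7) (Var 1) (Var 2))) \<^bold>\<and>
        \<^bold>\<not> mem_coded_fm (Var 3) (Var 5) (Var 6)))))))"])
     (use T in \<open>auto simp: iff_conv_conj_imp\<close>)
  have H_iff: "zero_ok l n y \<longleftrightarrow> pr (pr l n) y \<in> H" for l n y by (simp add: H_def)
  define path where "path l n m \<longleftrightarrow> (\<forall>y. y \<prec> m \<longrightarrow> (y \<in> coded l n \<longleftrightarrow> \<not> zero_ok l n y))" for l n m
  have path_unique: "z \<in> coded l n \<longleftrightarrow> z \<in> coded l' n'"
    if "path l n m" "path l' n' m" "z \<prec> m" for l n l' n' m z
  proof -
    \<comment> \<open>The decision at \<open>y\<close> depends only on the segment below
      \<open>y\<close>, so induction shows that two paths agree.\<close>
    have "\<forall>y. y \<prec> z \<oplus> \<one> \<longrightarrow> y \<prec> m \<longrightarrow> (y \<in> coded l n \<longleftrightarrow> y \<in> coded l' n')"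
    proof (rule arithmetical_induct[where n = 0 and S = "\<lambda>_. T" and a = "z \<oplus> \<one>"
          and e = "(\<lambda>_. m)(2 := l, 3 := n, 4 := l', 5 := n')"
          and \<phi> = "All 6 (Var 6 \<^bold>< Var 0 \<^bold>\<longrightarrow> Var 6 \<^bold>< Var 1 \<^bold>\<longrightarrow>
            (mem_coded_fm (Var 6) (Var 2) (Var 3) \<^bold>\<longleftrightarrow> mem_coded_fm (Var 6) (Var 4) (Var 5)))"])
      fix a assume IH: "\<forall>y. y \<prec> a \<longrightarrow> y \<prec> m \<longrightarrow> (y \<in> coded l n \<longleftrightarrow> y \<in> coded l' n')"
      have "a \<in> coded l n \<longleftrightarrow> a \<in> coded l' n'" if "a \<prec> m"
      proof -
        have "zero_ok l n a \<longleftrightarrow> zero_ok l' n' a"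
          by (rule zero_ok_cong) (use IH that less_transitive in blast)
        then show ?thesis using \<open>path l n m\<close> \<open>path l' n' m\<close> that by (simp add: path_def)
      qed
      then show "\<forall>y. y \<prec> a \<oplus> \<one> \<longrightarrow> y \<prec> m \<longrightarrow> (y \<in> coded l n \<longleftrightarrow> y \<in> coded l' n')"
        using IH by (auto simp: less_succ)
    qed (use T in \<open>auto simp: not_less_zero iff_conv_conj_imp\<close>)
    then show ?thesis using that(3) less_succ by blast
  qed
  have path_ex: "\<exists>l n. path l n m" for m
  proof (rule arithmetical_induct[where n = 0 and S = "\<lambda>_. H" and a = m and \<phi> =
      "Ex 1 (Ex 2 (All 3 (Var 3 \<^bold>< Var 0 \<^bold>\<longrightarrow> (mem_coded_fm (Var 3) (Var 1) (Var 2) \<^bold>\<longleftrightarrow>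
        \<^bold>\<not> (pair (pair (Var 1) (Var 2)) (Var 3) \<^bold>\<in> 0)))))"])
    fix m assume "\<exists>l n. path l n m"
    then obtain l n where p: "path l n m" by blast
    \<comment> \<open>The old segment with its value at \<open>m\<close> decided; it gets a new
      code, possibly with another \<open>l\<close>.\<close>
    let ?A = "{z. z \<prec> m \<and> z \<in> coded l n \<or> z = m \<and> \<not> zero_ok l n m}"
    have "?A \<in> Sets M"
      by (rule comprehension[where n = 0 and S = "\<lambda>_. H" and e = "(\<lambda>_. m)(2 := l, 3 := n)" and \<phi> =
        "Var 0 \<^bold>< Var 1 \<^bold>\<and> mem_coded_fm (Var 0) (Var 2) (Var 3) \<^bold>\<or>
          Var 0 \<^bold>= Var 1 \<^bold>\<and> \<^bold>\<not> (pair (pair (Var 2) (Var 3)) (Var 1) \<^bold>\<in> 0)"])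
        (use H H_iff in auto)
    then obtain l' n' where c: "\<And>z. z \<prec> m \<oplus> \<one> \<Longrightarrow> z \<in> coded l' n' \<longleftrightarrow> z \<in> ?A"
      using ex_coded by blast
    have below: "z \<in> coded l' n' \<longleftrightarrow> z \<in> coded l n" if "z \<prec> m" for z
      using c[of z] that not_less_self by (auto simp: less_succ)
    have "zero_ok l' n' y \<longleftrightarrow> zero_ok l n y" if "y \<prec> m \<or> y = m" for y
      by (rule zero_ok_cong) (use below that less_transitive in blast)
    then have "path l' n' (m \<oplus> \<one>)"
      using p below c[of m] not_less_self unfolding path_def less_succ by auto
    then show "\<exists>l n. path l n (m \<oplus> \<one>)" by blast
  qed (use H in \<open>auto simp: not_less_zero path_def H_iff iff_conv_conj_imp\<close>)
  define C where "C = {y. \<exists>l n. path l n (y \<oplus> \<one>) \<and> y \<in> coded l n}"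
  have C: "C \<in> Sets M"
    unfolding C_def path_def
    by (rule comprehension[where n = 0 and S = "\<lambda>_. H" and \<phi> =
      "Ex 1 (Ex 2 (All 3 (Var 3 \<^bold>< Var 0 \<^bold>+ One \<^bold>\<longrightarrow> (mem_coded_fm (Var 3) (Var 1) (Var 2) \<^bold>\<longleftrightarrow>
        \<^bold>\<not> (pair (pair (Var 1) (Var 2)) (Var 3) \<^bold>\<in> 0))) \<^bold>\<and> mem_coded_fm (Var 0) (Var 1) (Var 2)))"])
     (use H in \<open>auto simp: H_iff iff_conv_conj_imp\<close>)
  have C_path: "z \<in> C \<longleftrightarrow> z \<in> coded l n" if "path l n m" "z \<prec> m" for l n m z
  proof -
    have "path l n (z \<oplus> \<one>)" using that less_transitive unfolding path_def less_succ by blast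
    then show ?thesis unfolding C_def using path_unique less_succ by blast
  qed
  \<comment> \<open>Invariant of the leftmost path: its segment below \<open>m\<close> is matched by
    members of \<open>T\<close> at every level.\<close>
  have "\<forall>b. \<exists>l n. pr (pr l n) b \<in> T \<and> (\<forall>z. z \<prec> m \<longrightarrow> (z \<in> coded l n \<longleftrightarrow> z \<in> C))" for m
  proof (rule arithmetical_induct[where n = 0 and S = "(\<lambda>_. T)(1 := C)" and a = m and \<phi> =
      "All 1 (Ex 2 (Ex 3 (pair (pair (Var 2) (Var 3)) (Var 1) \<^bold>\<in> 0 \<^bold>\<and>
        All 4 (Var 4 \<^bold>< Var 0 \<^bold>\<longrightarrow> (mem_coded_fm (Var 4) (Var 2) (Var 3) \<^bold>\<longleftrightarrow> Var 4 \<^bold>\<in> 1)))))"])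
    fix m assume IH: "\<forall>b. \<exists>l n. pr (pr l n) b \<in> T \<and> (\<forall>z. z \<prec> m \<longrightarrow> (z \<in> coded l n \<longleftrightarrow> z \<in> C))"
    obtain l n where p: "path l n (m \<oplus> \<one>)" using path_ex by blast
    have m: "m \<in> C \<longleftrightarrow> \<not> zero_ok l n m"
      using C_path[OF p] p less_succ unfolding path_def by blast
    have below: "z \<in> coded l n \<longleftrightarrow> z \<in> C" if "z \<prec> m" for z
      using C_path[OF p] that less_succ by blast
    show "\<forall>b. \<exists>l n. pr (pr l n) b \<in> T \<and> (\<forall>z. z \<prec> m \<oplus> \<one> \<longrightarrow> (z \<in> coded l n \<longleftrightarrow> z \<in> C))"
    proof
      fix b
      show "\<exists>l n. pr (pr l n) b \<in> T \<and> (\<forall>z. z \<prec> m \<oplus> \<one> \<longrightarrow> (z \<in> coded l n \<longleftrightarrow> z \<in> C))"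
      proof (cases "zero_ok l n m")
        case True
        then obtain l' n' where "pr (pr l' n') b \<in> T" "m \<notin> coded l' n'"
          "\<And>z. z \<prec> m \<Longrightarrow> z \<in> coded l' n' \<longleftrightarrow> z \<in> coded l n" unfolding zero_ok_def by blast
        then show ?thesis using m True below unfolding less_succ by blast
      next
        case False
        then obtain b0 where b0: "\<And>l' n'. pr (pr l' n') b0 \<in> T \<Longrightarrow>
          (\<And>z. z \<prec> m \<Longrightarrow> z \<in> coded l' n' \<longleftrightarrow> z \<in> coded l n) \<Longrightarrow> m \<in> coded l' n'"
          unfolding zero_ok_def by blast
        \<comment> \<open>If leaving out \<open>m\<close> fails at level \<open>b0\<close>, a member
          at level \<open>b + b0\<close> also lies at levels \<open>b\<close> and \<open>b0\<close>
          by monotonicity; the latter forces it to contain \<open>m\<close>, as \<open>C\<close>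
          does.\<close>
        obtain l' n' where ln: "pr (pr l' n') (b \<oplus> b0) \<in> T"
          "\<And>z. z \<prec> m \<Longrightarrow> z \<in> coded l' n' \<longleftrightarrow> z \<in> C" using IH by blast
        have "b \<preceq> b \<oplus> b0" "b0 \<preceq> b \<oplus> b0" using zero_le by auto
        then have "pr (pr l' n') b \<in> T" "pr (pr l' n') b0 \<in> T" using mono ln(1) by blast+
        moreover from this have "m \<in> coded l' n'" using b0 ln(2) below by blast
        ultimately show ?thesis using m False ln(2) unfolding less_succ by blast
      qed
    qed
  qed (use T C nonempty in \<open>auto simp: not_less_zero iff_conv_conj_imp\<close>)
  then show ?thesis using C by blast
qed

text \<open>Trades the set quantifier over colorings for number quantifiers over codes of finite
  colorings, which makes colorability arithmetical. The converse applies compactness to the tree of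
  these codes, with the bound \<open>b\<close> as level.\<close>

lemma has_coloring_iff:
  assumes V: "V \<in> Sets M" and E: "E \<in> Sets M" and graph: "graph V E i"
  shows "has_coloring V E i \<longleftrightarrow> (\<exists>k. \<forall>b. \<exists>l n. partial_coloring E i k b (coded l n))"
proof
  assume "has_coloring V E i"
  then show "\<exists>k. \<forall>b. \<exists>l n. partial_coloring E i k b (coded l n)"
    unfolding has_coloring_def using partial_coloring_of_coloring[OF V graph] by blast
next
  assume "\<exists>k. \<forall>b. \<exists>l n. partial_coloring E i k b (coded l n)"
  then obtain k where k: "\<And>b. \<exists>l n. partial_coloring E i k b (coded l n)" by blast
  define T where "T = {p. \<exists>l n b. p = pr (pr l n) b \<and> partial_coloring E i k b (coded l n)}"
  have "T \<in> Sets M"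
    unfolding T_def
    by (rule comprehension[where n = 0 and S = "\<lambda>_. E" and e = "(\<lambda>_. i)(5 := k)" and \<phi> =
      "Ex 1 (Ex 2 (Ex 3 (Var 0 \<^bold>= pair (pair (Var 1) (Var 2)) (Var 3) \<^bold>\<and> partial_coloring_fm)))"])
      (use E in auto)
  moreover have mem: "pr (pr l n) b \<in> T \<longleftrightarrow> partial_coloring E i k b (coded l n)" for l n b
    by (simp add: T_def)
  ultimately obtain C where C: "C \<in> Sets M"
    "\<And>m b. \<exists>l n. partial_coloring E i k b (coded l n) \<and> (\<forall>z. z \<prec> m \<longrightarrow> (z \<in> coded l n \<longleftrightarrow> z \<in> C))"
    using compactness[of T] k partial_coloring_antimono unfolding mem by blast
  have "partial_coloring E i k b C" for b
    using C(2)[of b "pr b k"] partial_coloring_local by blast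
  then show "has_coloring V E i" by (rule coloring_of_partial_colorings[OF V graph C(1)])
qed

lemma ex_decides_colorability:
  assumes V: "V \<in> Sets M" and E: "E \<in> Sets M" and graph: "\<And>i. graph V E i"
  shows "\<exists>F\<in>Sets M. decides_colorability V E F"
proof
  \<comment> \<open>Comprehension is over variable 4, the graph index in
    \<open>partial_coloring_fm\<close>.\<close>
  have "{i. \<exists>k. \<forall>b. \<exists>l n. partial_coloring E i k b (coded l n)} \<in> Sets M"
    by (rule comprehension[where n = 4 and S = "\<lambda>_. E" and
        \<phi> = "Ex 5 (All 3 (Ex 1 (Ex 2 partial_coloring_fm)))"]) (use E in auto)
  then have K: "{i. has_coloring V E i} \<in> Sets M" using has_coloring_iff[OF V E graph] by simp
  let ?P = "\<lambda>p. \<exists>i. p = pr i \<one> \<and> has_coloring V E i \<or> p = pr i \<zero> \<and> \<not> has_coloring V E i"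
  show "Collect ?P \<in> Sets M"
    by (rule comprehension[where n = 0 and S = "\<lambda>_. {i. has_coloring V E i}" and \<phi> =
      "Ex 1 (Var 0 \<^bold>= pair (Var 1) One \<^bold>\<and> Var 1 \<^bold>\<in> 0 \<^bold>\<or> Var 0 \<^bold>= pair (Var 1) Zero \<^bold>\<and> \<^bold>\<not> (Var 1 \<^bold>\<in> 0))"])
      (use K in auto)
  show "decides_colorability V E (Collect ?P)"
    using zero_neq_one unfolding decides_colorability_def by auto
qed

end

theorem theorem15:
  fixes M :: "'a l2"
  assumes "l2_structure M" and "M \<Turnstile> RCA0"
  shows "M \<Turnstile> ACA0 \<longleftrightarrow> M \<Turnstile> {colorability_function_exists}"
proof -
  interpret rca M using assms by unfold_locales
  show ?thesis
  proof
    assume "M \<Turnstile> ACA0"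
    then interpret aca M by unfold_locales
    show "M \<Turnstile> {colorability_function_exists}"
      unfolding models_colorability_iff using ex_decides_colorability by blast
  next
    assume "M \<Turnstile> {colorability_function_exists}"
    then show "M \<Turnstile> ACA0" using ACA0_of_projection projection_of_colorability by blast
  qed
qed

end
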